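(* Let $n\ge 2$ and let $\theta^* := (0,\dots,0,1,\dots,1)\in\mathbb{R}^n$ with jump at $j=\lceil n/2\rceil$, i.e. $\theta^*_i=0$ for $i<j$ and $\theta^*_i=1$ for $i\ge j$. For $\sigma>0$ let $Y\sim N_n(\theta^*,\sigma^2I_n)$ and let $\hat\theta^{(1)}_{V=1}$ be the constrained trend filtering estimator of order $r=1$ with tuning parameter $V=1$. Then $$\lim_{\sigma\downarrow0}\frac{1}{\sigma^2}R(\hat\theta^{(1)}_{V=1},\theta^* )\ge\frac{\log(n/2)}{2n}.$$
   Context: Estimator of order $r=1$: $\hat{\theta}^{(1)}_{V} := \operatorname{argmin}_{\theta\in\mathbb{R}^n}\{\frac12\|Y-\theta\|^2 : \sum_{i=2}^n|\theta_i-\theta_{i-1}|\le V\}$. Risk: $R(\hat\theta,\theta^* ) := \frac1n\mathbb{E}_{\theta^*}\|\hat\theta-\theta^*\|^2$, with $\|\cdot\|$ the Euclidean norm. The paper assumes $n \ge 2r$ throughout (here $r=1$). *)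

theory Defs
  imports "HOL-Probability.Probability"
begin

text \<open>
  Points of \<open>\<real>\<^sup>n\<close> are the extensional functions \<open>nat \<Rightarrow> real\<close> on the index set \<open>{1..n}\<close>, that is, the
  elements of \<open>{1..n} \<rightarrow>\<^sub>E UNIV\<close>. Their Euclidean norm is \<open>L2_set\<close> over \<open>{1..n}\<close>.
\<close>

definition eucl_dist :: "nat \<Rightarrow> (nat \<Rightarrow> real) \<Rightarrow> (nat \<Rightarrow> real) \<Rightarrow> real" where
  "eucl_dist n x y = L2_set (\<lambda>i. x i - y i) {1..n}"

definition total_variation :: "nat \<Rightarrow> (nat \<Rightarrow> real) \<Rightarrow> real" where
  "total_variation n \<theta> = (\<Sum>i = 2..n. \<bar>\<theta> i - \<theta> (i - 1)\<bar>)"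

text \<open>
  For \<open>V \<ge> 0\<close> a strictly convex coercive function is minimised over a nonempty closed convex set,
  so there is exactly one minimiser. Without the restriction to extensional functions it would
  be unique only up to its values outside \<open>{1..n}\<close>.
\<close>

definition tf_estimator :: "nat \<Rightarrow> real \<Rightarrow> (nat \<Rightarrow> real) \<Rightarrow> (nat \<Rightarrow> real)" where
  "tf_estimator n V Y =
     arg_min_on (\<lambda>\<theta>. 1 / 2 * (eucl_dist n Y \<theta>)\<^sup>2)
       {\<theta> \<in> {1..n} \<rightarrow>\<^sub>E UNIV. total_variation n \<theta> \<le> V}"

text \<open>
  \<open>N\<^sub>n(\<mu>, \<sigma>\<^sup>2 I\<^sub>n)\<close> as the law of a vector of independent \<open>N(\<mu>\<^sub>i, \<sigma>\<^sup>2)\<close> coordinates.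
  The second argument of \<open>normal_density\<close> is the standard deviation.
\<close>

definition gaussian_iso :: "nat \<Rightarrow> (nat \<Rightarrow> real) \<Rightarrow> real \<Rightarrow> (nat \<Rightarrow> real) measure" where
  "gaussian_iso n \<mu> \<sigma> =
     (\<Pi>\<^sub>M i\<in>{1..n}. density lborel (\<lambda>x. ennreal (normal_density (\<mu> i) \<sigma> x)))"

definition risk ::
  "nat \<Rightarrow> real \<Rightarrow> ((nat \<Rightarrow> real) \<Rightarrow> (nat \<Rightarrow> real)) \<Rightarrow> (nat \<Rightarrow> real) \<Rightarrow> real" where
  "risk n \<sigma> est \<theta> =
     1 / real n * (\<integral>Y. (eucl_dist n (est Y) \<theta>)\<^sup>2 \<partial>gaussian_iso n \<theta> \<sigma>)"

definition step_signal :: "nat \<Rightarrow> (nat \<Rightarrow> real)" where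
  "step_signal n = (\<lambda>i\<in>{1..n}. if int i < \<lceil>real n / 2\<rceil> then 0 else 1)"

end

theory Submission
  imports Defs
begin

text \<open>
  Write \<open>Y = \<theta> + \<sigma> Z\<close> with standard Gaussian noise \<open>Z\<close>, where \<open>\<theta>\<close> is the step signal. The
  estimator is the Euclidean projection of \<open>Y\<close> onto a convex set \<open>K\<close> that contains \<open>\<theta>\<close>, so the
  error divided by \<open>\<sigma>\<close> is the projection of \<open>Z\<close> onto \<open>(K - \<theta>) / \<sigma>\<close>. These sets grow to the
  tangent cone of \<open>K\<close> at \<open>\<theta>\<close> as \<open>\<sigma>\<close> decreases to \<open>0\<close>.

  The limit exists because the squared norm of the rescaled error decreases in \<open>\<sigma>\<close> for every
  fixed \<open>Z\<close> (\<open>noise_ray_monotone\<close>) and is bounded by \<open>\<parallel>Z\<parallel>\<^sup>2\<close>; its expectation is then monotone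
  and bounded, and the limit dominates each of its values.

  For the lower bound, the tangent cone contains all vectors that vanish before the jump \<open>j\<close>
  and are nondecreasing and nonpositive on the block \<open>{j..n}\<close> (for \<open>n = 2\<close> there is no jump,
  and the bound is \<open>0\<close>): moving \<open>\<theta>\<close> in such a direction lowers the jump by at least as much as
  it adds variation after the jump (\<open>total_variation_step_perturbed\<close>). Hence the limit is at
  least \<open>1 / n\<close> times the expected squared norm of the projection of \<open>Z\<close> onto this smaller cone
  (\<open>rescaled_error_tangent\<close>, \<open>integral_gain_le_of_rescaled_error\<close>).

  That expectation is half a harmonic number (\<open>integral_isotonic_gain_nonpos\<close>). For all monotone
  vectors on a block of length \<open>m\<close>, lengthening the block by one entry adds exactly
  \<open>1 / (m + 1)\<close>; this rests on a cyclic rotation of the longer block after it has been centred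
  (\<open>integral_isotonic_gain_Suc\<close>). By symmetry nonpositive and nonnegative monotone vectors
  contribute equally. The block here has length \<open>n + 1 - j \<ge> n / 2\<close>, and the harmonic number
  of \<open>m\<close> is at least \<open>ln (m + 1)\<close>.
\<close>

section \<open>Projection onto the total variation ball\<close>

lemma total_variation_restrict:
  "total_variation n (restrict \<theta> {1..n}) = total_variation n \<theta>"
  unfolding total_variation_def by (intro sum.cong) auto

lemma total_variation_convex:
  assumes "0 \<le> t" "t \<le> 1"
  shows "total_variation n (\<lambda>i. \<theta> i + t * (\<theta>' i - \<theta> i))
           \<le> (1 - t) * total_variation n \<theta> + t * total_variation n \<theta>'"
proof -
  have "\<bar>(\<theta> i + t * (\<theta>' i - \<theta> i)) - (\<theta> (i - 1) + t * (\<theta>' (i - 1) - \<theta> (i - 1)))\<bar>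
      \<le> (1 - t) * \<bar>\<theta> i - \<theta> (i - 1)\<bar> + t * \<bar>\<theta>' i - \<theta>' (i - 1)\<bar>" for i
  proof -
    have "(\<theta> i + t * (\<theta>' i - \<theta> i)) - (\<theta> (i - 1) + t * (\<theta>' (i - 1) - \<theta> (i - 1)))
        = (1 - t) * (\<theta> i - \<theta> (i - 1)) + t * (\<theta>' i - \<theta>' (i - 1))"
      by (simp add: algebra_simps)
    also have "\<bar>\<dots>\<bar> \<le> \<bar>(1 - t) * (\<theta> i - \<theta> (i - 1))\<bar> + \<bar>t * (\<theta>' i - \<theta>' (i - 1))\<bar>"
      by (rule abs_triangle_ineq)
    finally show ?thesis
      using assms by (simp add: abs_mult)
  qed
  then show ?thesis
    unfolding total_variation_def sum_distrib_left sum.distrib[symmetric]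
    by (intro sum_mono)
qed

lemma eucl_dist_sq: "(eucl_dist n x y)\<^sup>2 = (\<Sum>i = 1..n. (x i - y i)\<^sup>2)"
  unfolding eucl_dist_def L2_set_def by (simp add: sum_nonneg)

text \<open>
  A minimiser exists by compactness: any competitor at least as good as \<open>0\<close> lies within
  \<open>\<parallel>Y\<parallel>\<close> of \<open>Y\<close> in every coordinate. Fixing the coordinates outside \<open>{1..n}\<close> to \<open>undefined\<close> turns
  that box into a product of compact sets over all of \<open>nat\<close>, to which Tychonoff's theorem applies.
\<close>

lemma tf_estimator_minimises:
  assumes "0 \<le> V"
  shows "total_variation n (tf_estimator n V Y) \<le> V"
    and "total_variation n \<theta> \<le> V \<Longrightarrow>
           (\<Sum>i = 1..n. (Y i - tf_estimator n V Y i)\<^sup>2) \<le> (\<Sum>i = 1..n. (Y i - \<theta> i)\<^sup>2)"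
proof -
  define K where "K = {\<theta> \<in> {1..n} \<rightarrow>\<^sub>E (UNIV :: real set). total_variation n \<theta> \<le> V}"
  define f where "f \<theta> = 1 / 2 * (eucl_dist n Y \<theta>)\<^sup>2" for \<theta>
  define r where "r = sqrt (\<Sum>i = 1..n. (Y i)\<^sup>2)"
  define B where "B = PiE UNIV (\<lambda>i::nat. if i \<in> {1..n} then {Y i - r..Y i + r} else {undefined::real})"
  have r0: "0 \<le> r" by (simp add: r_def sum_nonneg)
  have comp: "compact B"
  proof -
    have "compactin (product_topology (\<lambda>_. euclidean) UNIV) B"
      unfolding B_def compactin_PiE by auto
    then show ?thesis
      by (simp add: euclidean_product_topology flip: compactin_euclidean_iff)
  qed
  have cont_coord: "continuous_on UNIV (\<lambda>x::nat \<Rightarrow> real. x i)" for i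
    by (rule continuous_on_product_coordinates)
  have clos: "closed {\<theta>. total_variation n \<theta> \<le> V}"
    unfolding total_variation_def
    by (intro closed_Collect_le continuous_intros cont_coord)
  have BK: "B \<inter> {\<theta>. total_variation n \<theta> \<le> V} = {\<theta> \<in> K. \<forall>i\<in>{1..n}. \<bar>Y i - \<theta> i\<bar> \<le> r}"
  proof -
    have "\<theta> \<in> B \<longleftrightarrow> \<theta> \<in> {1..n} \<rightarrow>\<^sub>E UNIV \<and> (\<forall>i\<in>{1..n}. \<bar>Y i - \<theta> i\<bar> \<le> r)" for \<theta>
    proof -
      have "Y i - r \<le> \<theta> i \<and> \<theta> i \<le> Y i + r \<longleftrightarrow> \<bar>Y i - \<theta> i\<bar> \<le> r" for i by linarith
      then show ?thesis
        unfolding B_def PiE_UNIV_domain Pi_iff PiE_iff extensional_def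
        by (auto split: if_splits)
    qed
    then show ?thesis unfolding K_def by blast
  qed
  define z where "z = (\<lambda>i\<in>{1..n}. 0::real)"
  have "total_variation n z = total_variation n (\<lambda>_. 0)"
    unfolding z_def by (rule total_variation_restrict)
  then have zK: "z \<in> K"
    using assms by (simp add: K_def z_def total_variation_def)
  have fz: "f z = 1 / 2 * r\<^sup>2"
    unfolding f_def eucl_dist_sq r_def z_def by (simp add: sum_nonneg)
  have near: "\<bar>Y i - \<theta> i\<bar> \<le> r" if "f \<theta> \<le> f z" "i \<in> {1..n}" for i \<theta>
  proof -
    have "(Y i - \<theta> i)\<^sup>2 \<le> (\<Sum>i = 1..n. (Y i - \<theta> i)\<^sup>2)"
      using that(2) by (intro member_le_sum) auto
    also have "\<dots> \<le> r\<^sup>2"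
      using that(1) by (simp add: fz) (simp add: f_def eucl_dist_sq)
    finally show ?thesis
      using r0 abs_le_square_iff by force
  qed
  have "compact (B \<inter> {\<theta>. total_variation n \<theta> \<le> V})"
    using comp clos by (rule compact_Int_closed)
  moreover have zB: "z \<in> B \<inter> {\<theta>. total_variation n \<theta> \<le> V}"
    unfolding BK using zK near[of z] by auto
  moreover have "continuous_on (B \<inter> {\<theta>. total_variation n \<theta> \<le> V}) f"
    unfolding f_def eucl_dist_sq
    by (intro continuous_intros continuous_on_subset[OF cont_coord]) auto
  ultimately obtain p where p: "p \<in> B \<inter> {\<theta>. total_variation n \<theta> \<le> V}"
      "\<forall>\<theta> \<in> B \<inter> {\<theta>. total_variation n \<theta> \<le> V}. f p \<le> f \<theta>"
    using continuous_attains_inf[of "B \<inter> {\<theta>. total_variation n \<theta> \<le> V}" f] by auto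
  have pK: "p \<in> K" using p(1) unfolding BK by auto
  have "f p \<le> f \<theta>" if "\<theta> \<in> K" for \<theta>
  proof (cases "f \<theta> \<le> f z")
    case True
    then show ?thesis using p(2) near[of \<theta>] that unfolding BK by auto
  next
    case False
    have "f p \<le> f z" using p(2) zB by blast
    with False show ?thesis by simp
  qed
  with pK have "is_arg_min f (\<lambda>\<theta>. \<theta> \<in> K) p"
    by (auto simp: is_arg_min_linorder)
  then have "is_arg_min f (\<lambda>\<theta>. \<theta> \<in> K) (arg_min_on f K)"
    unfolding arg_min_on_def arg_min_def by (rule someI[where P = "is_arg_min f (\<lambda>\<theta>. \<theta> \<in> K)"])
  moreover have "tf_estimator n V Y = arg_min_on f K"
    unfolding tf_estimator_def f_def K_def ..
  ultimately have *: "tf_estimator n V Y \<in> K" "\<And>\<theta>. \<theta> \<in> K \<Longrightarrow> f (tf_estimator n V Y) \<le> f \<theta>"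
    by (auto simp: is_arg_min_linorder)
  show "total_variation n (tf_estimator n V Y) \<le> V"
    using *(1) unfolding K_def by auto
  assume "total_variation n \<theta> \<le> V"
  then have "restrict \<theta> {1..n} \<in> K"
    by (simp add: K_def total_variation_restrict del: One_nat_def)
  from *(2)[OF this] show "(\<Sum>i = 1..n. (Y i - tf_estimator n V Y i)\<^sup>2) \<le> (\<Sum>i = 1..n. (Y i - \<theta> i)\<^sup>2)"
    unfolding f_def eucl_dist_sq by simp
qed

text \<open>
  The obtuse-angle characterisation of a projection onto a convex set. It is stated for all
  \<open>\<theta>\<close> of small total variation, extensional or not, so that later arguments can move along
  segments and rays without restricting back to \<open>{1..n}\<close>.
\<close>

lemma tf_estimator_variational:
  assumes "0 \<le> V" and \<theta>: "total_variation n \<theta> \<le> V"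
  shows "(\<Sum>i = 1..n. (Y i - tf_estimator n V Y i) * (\<theta> i - tf_estimator n V Y i)) \<le> 0"
proof -
  define p where "p = tf_estimator n V Y"
  define A where "A = (\<Sum>i = 1..n. (Y i - p i) * (\<theta> i - p i))"
  define Q where "Q = (\<Sum>i = 1..n. (\<theta> i - p i)\<^sup>2)"
  have le: "2 * A \<le> t * Q" if t: "0 < t" "t \<le> 1" for t
  proof -
    have "total_variation n (\<lambda>i. p i + t * (\<theta> i - p i)) \<le> (1 - t) * total_variation n p + t * total_variation n \<theta>"
      using t by (intro total_variation_convex) auto
    also have "\<dots> \<le> (1 - t) * V + t * V"
      using t \<theta> tf_estimator_minimises(1)[OF assms(1), of n Y] unfolding p_def
      by (intro add_mono mult_left_mono) auto
    finally have "total_variation n (\<lambda>i. p i + t * (\<theta> i - p i)) \<le> V" by (simp add: algebra_simps)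
    from tf_estimator_minimises(2)[OF assms(1) this, of Y]
    have "(\<Sum>i = 1..n. (Y i - p i)\<^sup>2) \<le> (\<Sum>i = 1..n. (Y i - (p i + t * (\<theta> i - p i)))\<^sup>2)"
      by (simp add: p_def)
    also have "\<dots> = (\<Sum>i = 1..n. (Y i - p i)\<^sup>2 - 2 * t * ((Y i - p i) * (\<theta> i - p i)) + t\<^sup>2 * (\<theta> i - p i)\<^sup>2)"
      by (intro sum.cong) (auto simp: power2_eq_square algebra_simps)
    also have "\<dots> = (\<Sum>i = 1..n. (Y i - p i)\<^sup>2) - 2 * t * A + t\<^sup>2 * Q"
      by (simp add: A_def Q_def sum.distrib sum_subtractf sum_distrib_left)
    finally have "t * (2 * A) \<le> t * (t * Q)" by (simp add: power2_eq_square algebra_simps)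
    then show ?thesis using t by simp
  qed
  have "2 * A \<le> 0"
  proof (rule field_le_epsilon)
    fix e :: real assume e: "0 < e"
    have Q: "0 \<le> Q" by (simp add: Q_def sum_nonneg)
    define t where "t = min 1 (e / (Q + 1))"
    have t: "0 < t" "t \<le> 1" using e Q by (auto simp: t_def)
    have "t * Q \<le> e / (Q + 1) * Q" using Q by (intro mult_right_mono) (auto simp: t_def)
    also have "\<dots> \<le> e" using e Q by (simp add: field_simps)
    finally show "2 * A \<le> 0 + e" using le[OF t] by simp
  qed
  then show ?thesis by (simp add: A_def p_def)
qed

text \<open>
  Expanding \<open>0 \<le> \<parallel>x - u\<parallel>\<^sup>2\<close> gives this without the Cauchy-Schwarz inequality.
\<close>

lemma sum_sq_le_of_sum_sq_le_inner:
  fixes u x :: "'a \<Rightarrow> real"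
  assumes "(\<Sum>i\<in>I. (u i)\<^sup>2) \<le> (\<Sum>i\<in>I. x i * u i)"
  shows "(\<Sum>i\<in>I. (u i)\<^sup>2) \<le> (\<Sum>i\<in>I. (x i)\<^sup>2)"
proof -
  have "0 \<le> (\<Sum>i\<in>I. (x i - u i)\<^sup>2)" by (simp add: sum_nonneg)
  also have "\<dots> = (\<Sum>i\<in>I. (x i)\<^sup>2 - 2 * (x i * u i) + (u i)\<^sup>2)"
    by (intro sum.cong) (auto simp: power2_eq_square algebra_simps)
  also have "\<dots> = (\<Sum>i\<in>I. (x i)\<^sup>2) - 2 * (\<Sum>i\<in>I. x i * u i) + (\<Sum>i\<in>I. (u i)\<^sup>2)"
    by (simp add: sum.distrib sum_subtractf sum_distrib_left)
  finally show ?thesis using assms by simp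
qed

lemma tf_estimator_lipschitz:
  assumes "0 \<le> V"
  shows "(\<Sum>i = 1..n. (tf_estimator n V x i - tf_estimator n V y i)\<^sup>2) \<le> (\<Sum>i = 1..n. (x i - y i)\<^sup>2)"
proof (rule sum_sq_le_of_sum_sq_le_inner)
  define p where "p = tf_estimator n V x"
  define q where "q = tf_estimator n V y"
  have "(\<Sum>i = 1..n. (x i - p i) * (q i - p i)) \<le> 0" "(\<Sum>i = 1..n. (y i - q i) * (p i - q i)) \<le> 0"
    unfolding p_def q_def
    by (intro tf_estimator_variational assms tf_estimator_minimises(1))+
  then have "0 \<le> - (\<Sum>i = 1..n. (x i - p i) * (q i - p i)) - (\<Sum>i = 1..n. (y i - q i) * (p i - q i))" by simp
  also have "\<dots> = (\<Sum>i = 1..n. (x i - y i) * (p i - q i)) - (\<Sum>i = 1..n. (p i - q i)\<^sup>2)"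
    unfolding sum_negf[symmetric] sum_subtractf[symmetric]
    by (intro sum.cong) (auto simp: power2_eq_square algebra_simps)
  finally show "(\<Sum>i = 1..n. (p i - q i)\<^sup>2) \<le> (\<Sum>i = 1..n. (x i - y i) * (p i - q i))" by simp
qed

lemma tf_estimator_feasible:
  assumes "0 \<le> V" "total_variation n \<theta> \<le> V" "i \<in> {1..n}"
  shows "tf_estimator n V \<theta> i = \<theta> i"
proof -
  have "(\<Sum>i = 1..n. (\<theta> i - tf_estimator n V \<theta> i)\<^sup>2) \<le> 0"
    using tf_estimator_minimises(2)[OF assms(1,2), of \<theta>] by simp
  then have "(\<Sum>i = 1..n. (\<theta> i - tf_estimator n V \<theta> i)\<^sup>2) = 0"
    by (intro antisym) (simp_all add: sum_nonneg)
  then show ?thesis using assms(3) by (simp add: sum_nonneg_eq_0_iff)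
qed

text \<open>
  For a projection \<open>\<Pi>\<close> onto a convex set, \<open>\<parallel>\<Pi>(t z)\<parallel> / t\<close> decreases in \<open>t\<close>. With \<open>a = \<Pi>(z)\<close>,
  \<open>b = \<Pi>(t z)\<close> and \<open>t \<ge> 1\<close>, adding \<open>t\<close> times the variational inequality at \<open>a\<close> to the one at
  \<open>b\<close> eliminates \<open>z\<close> and leaves \<open>\<langle>b - t a, b - a\<rangle> \<le> 0\<close>: the point \<open>b\<close> lies in the ball that has
  \<open>a\<close> and \<open>t a\<close> as opposite ends of a diameter, hence \<open>\<parallel>b\<parallel> \<le> t \<parallel>a\<parallel>\<close>. Here the origin is \<open>\<mu>\<close>.
\<close>

lemma noise_ray_monotone:
  fixes n :: nat and V :: real and \<mu> Z :: "nat \<Rightarrow> real"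
  defines "u \<sigma> \<equiv> (\<lambda>i. tf_estimator n V (\<lambda>i. \<mu> i + \<sigma> * Z i) i - \<mu> i)"
  assumes "0 \<le> V" "0 < s" "s \<le> \<sigma>"
  shows "(1 / \<sigma>\<^sup>2) * (\<Sum>i = 1..n. (u \<sigma> i)\<^sup>2) \<le> (1 / s\<^sup>2) * (\<Sum>i = 1..n. (u s i)\<^sup>2)"
proof -
  define t where "t = \<sigma> / s"
  have t: "1 \<le> t" "\<sigma> = t * s" using assms(3,4) by (auto simp: t_def)
  define a where "a = u s"
  define b where "b = u \<sigma>"
  have "(\<Sum>i = 1..n. (\<mu> i + s * Z i - (\<mu> i + a i)) * (\<mu> i + b i - (\<mu> i + a i))) \<le> 0"
       "(\<Sum>i = 1..n. (\<mu> i + \<sigma> * Z i - (\<mu> i + b i)) * (\<mu> i + a i - (\<mu> i + b i))) \<le> 0"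
    unfolding a_def b_def u_def
    using tf_estimator_variational[OF assms(2) tf_estimator_minimises(1)[OF assms(2)]]
    by simp_all
  then have "t * (\<Sum>i = 1..n. (\<mu> i + s * Z i - (\<mu> i + a i)) * (\<mu> i + b i - (\<mu> i + a i)))
       + (\<Sum>i = 1..n. (\<mu> i + \<sigma> * Z i - (\<mu> i + b i)) * (\<mu> i + a i - (\<mu> i + b i))) \<le> 0"
    using t(1) by (smt (verit) mult_nonneg_nonpos)
  also have "t * (\<Sum>i = 1..n. (\<mu> i + s * Z i - (\<mu> i + a i)) * (\<mu> i + b i - (\<mu> i + a i)))
       + (\<Sum>i = 1..n. (\<mu> i + \<sigma> * Z i - (\<mu> i + b i)) * (\<mu> i + a i - (\<mu> i + b i)))
       = (\<Sum>i = 1..n. (b i - (1 + t) / 2 * a i)\<^sup>2 - ((t - 1) / 2 * a i)\<^sup>2)"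
    unfolding sum_distrib_left sum.distrib[symmetric] t(2)
    by (intro sum.cong) (auto simp: power2_eq_square field_simps)
  finally have "(\<Sum>i = 1..n. (b i - (1 + t) / 2 * a i)\<^sup>2) \<le> (\<Sum>i = 1..n. ((t - 1) / 2 * a i)\<^sup>2)"
    by (simp add: sum_subtractf)
  then have "L2_set (\<lambda>i. b i - (1 + t) / 2 * a i) {1..n} \<le> L2_set (\<lambda>i. (t - 1) / 2 * a i) {1..n}"
    unfolding L2_set_def by simp
  also have "\<dots> = (t - 1) / 2 * L2_set a {1..n}"
    using t(1) by (intro L2_set_right_distrib[symmetric]) auto
  finally have 1: "L2_set (\<lambda>i. b i - (1 + t) / 2 * a i) {1..n} \<le> (t - 1) / 2 * L2_set a {1..n}" .
  have "L2_set b {1..n} \<le> L2_set (\<lambda>i. b i - (1 + t) / 2 * a i) {1..n} + L2_set (\<lambda>i. (1 + t) / 2 * a i) {1..n}"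
    using L2_set_triangle_ineq[of "\<lambda>i. b i - (1 + t) / 2 * a i" "\<lambda>i. (1 + t) / 2 * a i" "{1..n}"] by simp
  also have "L2_set (\<lambda>i. (1 + t) / 2 * a i) {1..n} = (1 + t) / 2 * L2_set a {1..n}"
    using t(1) by (intro L2_set_right_distrib[symmetric]) auto
  also note 1
  finally have "L2_set b {1..n} \<le> t * L2_set a {1..n}" by (simp add: field_simps)
  then have "(L2_set b {1..n})\<^sup>2 \<le> (t * L2_set a {1..n})\<^sup>2" by (intro power_mono) auto
  then have "(\<Sum>i = 1..n. (b i)\<^sup>2) \<le> t\<^sup>2 * (\<Sum>i = 1..n. (a i)\<^sup>2)"
    by (simp add: L2_set_def sum_nonneg power_mult_distrib)
  moreover have "(1 / s\<^sup>2) * (\<Sum>i = 1..n. (a i)\<^sup>2) = (1 / \<sigma>\<^sup>2) * (t\<^sup>2 * (\<Sum>i = 1..n. (a i)\<^sup>2))"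
    using t assms(3) by (simp add: field_simps)
  ultimately show ?thesis
    unfolding a_def b_def by (simp add: divide_right_mono)
qed

section \<open>Symmetries and moments of the isotropic Gaussian\<close>

definition std_gaussian :: "nat \<Rightarrow> (nat \<Rightarrow> real) measure" where
  "std_gaussian n = gaussian_iso n (\<lambda>_. 0) 1"

lemma sets_gaussian_iso [simp, measurable_cong]:
  "sets (gaussian_iso n \<mu> \<sigma>) = sets (\<Pi>\<^sub>M i\<in>{1..n}. borel)"
  unfolding gaussian_iso_def by (intro sets_PiM_cong) auto

lemma sets_std_gaussian [simp, measurable_cong]:
  "sets (std_gaussian n) = sets (\<Pi>\<^sub>M i\<in>{1..n}. borel)"
  by (simp add: std_gaussian_def)

text \<open>
  On extensional functions the coordinates outside \<open>I\<close> are constant, so the inclusion of the finite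
  product into all of \<open>nat \<Rightarrow> real\<close> is measurable. Measurability questions can thus be settled
  for the Borel sets of the product topology, where continuity arguments apply.
\<close>

lemma borel_measurable_PiM_of_borel:
  assumes "f \<in> borel_measurable (borel :: (nat \<Rightarrow> real) measure)"
  shows "f \<in> borel_measurable (\<Pi>\<^sub>M i\<in>I. borel)"
proof -
  have "(\<lambda>x. x i) \<in> borel_measurable (\<Pi>\<^sub>M i\<in>I. (borel :: real measure))" for i
  proof (cases "i \<in> I")
    case True
    then show ?thesis by measurable
  next
    case False
    have "(\<lambda>x. undefined :: real) \<in> borel_measurable (\<Pi>\<^sub>M i\<in>I. (borel :: real measure))" by simp
    then show ?thesis
      by (rule measurable_cong[THEN iffD1, rotated]) (use False in \<open>auto simp: space_PiM PiE_def extensional_def\<close>)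
  qed
  then have "(\<lambda>x. x) \<in> measurable (\<Pi>\<^sub>M i\<in>I. (borel :: real measure)) borel"
    by (rule measurable_coordinatewise_then_product)
  from measurable_compose[OF this assms] show ?thesis .
qed

lemma borel_measurable_std_gaussian:
  assumes "f \<in> borel_measurable (borel :: (nat \<Rightarrow> real) measure)"
  shows "f \<in> borel_measurable (std_gaussian n)"
  using borel_measurable_PiM_of_borel[OF assms] by (simp cong: measurable_cong_sets)

lemma distr_std_normal_affine:
  assumes "\<alpha> \<noteq> 0"
  shows "distr (density lborel (normal_density 0 1)) lborel (\<lambda>x. \<beta> + \<alpha> * x)
           = density lborel (normal_density \<beta> \<bar>\<alpha>\<bar>)"
proof -
  interpret prob_space "density lborel (normal_density 0 1)"
    by (rule prob_space_normal_density) simp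
  have "distributed (density lborel (normal_density 0 1)) lborel (\<lambda>x. x) (normal_density 0 1)"
    unfolding distributed_def by (auto simp: distr_id2)
  from normal_density_affine[OF this _ assms, of \<beta>] show ?thesis
    unfolding distributed_def by simp
qed

text \<open>
  The factors \<open>\<alpha> i\<close> may differ in sign, so that this covers both the representation
  \<open>Y = \<mu> + \<sigma> Z\<close> and the invariance of the standard Gaussian under sign changes of coordinates.
\<close>

lemma distr_std_gaussian_affine:
  assumes "0 < \<sigma>" and \<alpha>: "\<And>i. i \<in> {1..n} \<Longrightarrow> \<bar>\<alpha> i\<bar> = \<sigma>"
  shows "distr (std_gaussian n) (gaussian_iso n \<mu> \<sigma>) (\<lambda>x. \<lambda>i\<in>{1..n}. \<mu> i + \<alpha> i * x i)
           = gaussian_iso n \<mu> \<sigma>"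
proof -
  define M where "M i = density lborel (\<lambda>x. ennreal (normal_density (\<mu> i) \<sigma> x))" for i
  define N where "N = (\<lambda>i::nat. density lborel (\<lambda>x. ennreal (normal_density 0 1 x)))"
  have M: "prob_space (M i)" for i
    unfolding M_def using assms(1) by (rule prob_space_normal_density)
  have N: "prob_space (N i)" for i
    unfolding N_def by (rule prob_space_normal_density) simp
  interpret M: product_sigma_finite M
    using M by (simp add: product_sigma_finite_def prob_space_imp_sigma_finite)
  interpret N: product_sigma_finite N
    using N by (simp add: product_sigma_finite_def prob_space_imp_sigma_finite)
  have [measurable_cong, simp]: "sets (M i) = sets borel" "sets (N i) = sets borel" for i
    by (simp_all add: M_def N_def)
  have [simp]: "space (N i) = UNIV" for i by (simp add: N_def)
  have 1: "std_gaussian n = PiM {1..n} N" "gaussian_iso n \<mu> \<sigma> = PiM {1..n} M"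
    by (simp_all add: std_gaussian_def gaussian_iso_def M_def[abs_def] N_def)
  have meas [measurable]:
      "(\<lambda>x. \<lambda>i\<in>{1..n}. \<mu> i + \<alpha> i * x i) \<in> measurable (PiM {1..n} N) (PiM {1..n} M)"
    by (rule measurable_restrict) measurable
  show ?thesis unfolding 1
  proof (rule M.PiM_eqI)
    fix A assume A: "\<And>i. i \<in> {1..n} \<Longrightarrow> A i \<in> sets (M i)"
    have m: "(\<lambda>x. \<mu> i + \<alpha> i * x) -` A i \<in> sets (N i)" if "i \<in> {1..n}" for i
      using A[OF that] measurable_sets[of "\<lambda>x. \<mu> i + \<alpha> i * x" borel borel "A i"] by simp
    have "emeasure (distr (PiM {1..n} N) (PiM {1..n} M) (\<lambda>x. \<lambda>i\<in>{1..n}. \<mu> i + \<alpha> i * x i)) (Pi\<^sub>E {1..n} A)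
        = emeasure (PiM {1..n} N)
            ((\<lambda>x. \<lambda>i\<in>{1..n}. \<mu> i + \<alpha> i * x i) -` Pi\<^sub>E {1..n} A \<inter> space (PiM {1..n} N))"
      using A by (intro emeasure_distr meas sets_PiM_I_finite) auto
    also have "(\<lambda>x. \<lambda>i\<in>{1..n}. \<mu> i + \<alpha> i * x i) -` Pi\<^sub>E {1..n} A \<inter> space (PiM {1..n} N)
        = Pi\<^sub>E {1..n} (\<lambda>i. (\<lambda>x. \<mu> i + \<alpha> i * x) -` A i)"
      by (auto simp: space_PiM PiE_iff)
    also have "emeasure (PiM {1..n} N) \<dots> = (\<Prod>i\<in>{1..n}. emeasure (N i) ((\<lambda>x. \<mu> i + \<alpha> i * x) -` A i))"
      by (rule N.emeasure_PiM) (use m in auto)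
    also have "\<dots> = (\<Prod>i\<in>{1..n}. emeasure (M i) (A i))"
    proof (rule prod.cong)
      fix i assume i: "i \<in> {1..n}"
      have "\<alpha> i \<noteq> 0" using \<alpha>[OF i] assms(1) by auto
      have "M i = distr (N i) lborel (\<lambda>x. \<mu> i + \<alpha> i * x)"
        unfolding M_def N_def distr_std_normal_affine[OF \<open>\<alpha> i \<noteq> 0\<close>] \<alpha>[OF i] ..
      then show "emeasure (N i) ((\<lambda>x. \<mu> i + \<alpha> i * x) -` A i) = emeasure (M i) (A i)"
        using A[OF i] by (simp add: emeasure_distr)
    qed simp
    finally show "emeasure (distr (PiM {1..n} N) (PiM {1..n} M) (\<lambda>x. \<lambda>i\<in>{1..n}. \<mu> i + \<alpha> i * x i))
        (Pi\<^sub>E {1..n} A) = (\<Prod>i\<in>{1..n}. emeasure (M i) (A i))" .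
  qed simp_all
qed

lemma integral_gaussian_iso_affine:
  fixes f :: "(nat \<Rightarrow> real) \<Rightarrow> real"
  assumes "0 < \<sigma>" "\<And>i. i \<in> {1..n} \<Longrightarrow> \<bar>\<alpha> i\<bar> = \<sigma>"
    and f: "f \<in> borel_measurable borel"
  shows "integral\<^sup>L (gaussian_iso n \<mu> \<sigma>) f
           = (\<integral>x. f (\<lambda>i\<in>{1..n}. \<mu> i + \<alpha> i * x i) \<partial>std_gaussian n)"
proof -
  have "f \<in> borel_measurable (gaussian_iso n \<mu> \<sigma>)"
    using borel_measurable_PiM_of_borel[OF f] by (simp cong: measurable_cong_sets)
  moreover have "(\<lambda>x. \<lambda>i\<in>{1..n}. \<mu> i + \<alpha> i * x i) \<in> measurable (std_gaussian n) (gaussian_iso n \<mu> \<sigma>)"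
  proof -
    have "(\<lambda>x. \<lambda>i\<in>{1..n}. \<mu> i + \<alpha> i * x i) \<in> measurable (\<Pi>\<^sub>M i\<in>{1..n}. borel) (\<Pi>\<^sub>M i\<in>{1..n}. (borel :: real measure))"
      by (rule measurable_restrict) measurable
    then show ?thesis by (simp cong: measurable_cong_sets)
  qed
  ultimately show ?thesis
    by (subst distr_std_gaussian_affine[OF assms(1,2), symmetric]) (auto intro: integral_distr)
qed

lemma integral_std_gaussian_flip:
  fixes f :: "(nat \<Rightarrow> real) \<Rightarrow> real"
  assumes "\<And>i. i \<in> {1..n} \<Longrightarrow> \<bar>\<alpha> i\<bar> = 1" and "f \<in> borel_measurable borel"
  shows "integral\<^sup>L (std_gaussian n) f = (\<integral>x. f (\<lambda>i\<in>{1..n}. \<alpha> i * x i) \<partial>std_gaussian n)"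
  using integral_gaussian_iso_affine[of 1 n \<alpha> f "\<lambda>_. 0"] assms by (simp add: std_gaussian_def)

lemma integral_std_gaussian_permute:
  fixes f :: "(nat \<Rightarrow> real) \<Rightarrow> real"
  assumes "inj_on \<pi> {1..n}" "\<pi> \<in> {1..n} \<rightarrow> {1..n}" and f: "f \<in> borel_measurable borel"
  shows "integral\<^sup>L (std_gaussian n) f = (\<integral>x. f (\<lambda>i\<in>{1..n}. x (\<pi> i)) \<partial>std_gaussian n)"
proof -
  have eq: "distr (std_gaussian n) (std_gaussian n) (\<lambda>x. \<lambda>i\<in>{1..n}. x (\<pi> i)) = std_gaussian n"
    unfolding std_gaussian_def gaussian_iso_def
    by (rule distr_PiM_reindex) (use assms prob_space_normal_density in auto)
  have "(\<lambda>x. \<lambda>i\<in>{1..n}. x (\<pi> i)) \<in> measurable (\<Pi>\<^sub>M i\<in>{1..n}. borel) (\<Pi>\<^sub>M i\<in>{1..n}. (borel :: real measure))"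
    by (rule measurable_restrict, rule measurable_component_singleton) (use assms(2) in auto)
  then have "(\<lambda>x. \<lambda>i\<in>{1..n}. x (\<pi> i)) \<in> measurable (std_gaussian n) (std_gaussian n)"
    by (simp cong: measurable_cong_sets)
  then show ?thesis
    by (subst eq[symmetric]) (intro integral_distr borel_measurable_std_gaussian f)
qed

lemma
  assumes i: "i \<in> {1..n}"
  shows integrable_std_gaussian_square: "integrable (std_gaussian n) (\<lambda>x. (x i)\<^sup>2)"
    and integral_std_gaussian_square: "(\<integral>x. (x i)\<^sup>2 \<partial>std_gaussian n) = 1"
proof -
  define N where "N = density lborel (\<lambda>x. ennreal (normal_density 0 1 x))"
  have "distr (\<Pi>\<^sub>M i\<in>{1..n}. N) N (\<lambda>x. x i) = N"
    by (rule distr_PiM_component) (use i prob_space_normal_density in \<open>auto simp: N_def\<close>)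
  then have d: "distr (std_gaussian n) N (\<lambda>x. x i) = N"
    by (simp add: std_gaussian_def gaussian_iso_def N_def)
  have m: "(\<lambda>x. x i) \<in> measurable (std_gaussian n) N"
    unfolding std_gaussian_def gaussian_iso_def N_def using i by (intro measurable_component_singleton)
  have h: "has_bochner_integral lborel (\<lambda>x. std_normal_density x * x\<^sup>2) 1"
    using std_normal_moment_even[of 1] by simp
  have "has_bochner_integral N (\<lambda>x. x\<^sup>2) 1"
    unfolding N_def by (rule has_bochner_integral_density) (use h in auto)
  then have h': "integrable N (\<lambda>x. x\<^sup>2)" "integral\<^sup>L N (\<lambda>x. x\<^sup>2) = 1"
    by (auto simp: has_bochner_integral_iff)
  have sq: "(\<lambda>x. x\<^sup>2) \<in> borel_measurable N" by (simp add: N_def)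
  show "integrable (std_gaussian n) (\<lambda>x. (x i)\<^sup>2)"
    using h'(1) d integrable_distr[OF m, of "\<lambda>x. x\<^sup>2"] by simp
  show "(\<integral>x. (x i)\<^sup>2 \<partial>std_gaussian n) = 1"
    using h'(2) d integral_distr[OF m sq] by simp
qed

lemma integrable_std_gaussian_dominated:
  fixes f :: "(nat \<Rightarrow> real) \<Rightarrow> real"
  assumes "f \<in> borel_measurable (std_gaussian n)"
    and "\<And>x. \<bar>f x\<bar> \<le> K * (\<Sum>i = 1..n. (x i)\<^sup>2)"
  shows "integrable (std_gaussian n) f"
proof (rule Bochner_Integration.integrable_bound)
  show "integrable (std_gaussian n) (\<lambda>x. K * (\<Sum>i = 1..n. (x i)\<^sup>2))"
    by (intro integrable_mult_right Bochner_Integration.integrable_sum integrable_std_gaussian_square)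
  show "AE x in std_gaussian n. norm (f x) \<le> norm (K * (\<Sum>i = 1..n. (x i)\<^sup>2))"
    using assms(2) by (intro AE_I2) (simp add: order_trans[OF _ abs_ge_self])
qed (rule assms(1))

lemma coordinate_borel [measurable]: "(\<lambda>x. x i) \<in> borel_measurable (borel :: (nat \<Rightarrow> real) measure)"
  by (rule borel_measurable_continuous_onI[OF continuous_on_product_coordinates])

lemma
  assumes "i \<in> {1..n}" "k \<in> {1..n}"
  shows integrable_std_gaussian_times: "integrable (std_gaussian n) (\<lambda>x. x i * x k)"
    and integral_std_gaussian_times: "(\<integral>x. x i * x k \<partial>std_gaussian n) = (if i = k then 1 else 0)"
proof -
  have m: "(\<lambda>x. x i * x k) \<in> borel_measurable (borel :: (nat \<Rightarrow> real) measure)" by measurable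
  show "integrable (std_gaussian n) (\<lambda>x. x i * x k)"
  proof (rule integrable_std_gaussian_dominated[where K = 1])
    show "\<bar>x i * x k\<bar> \<le> 1 * (\<Sum>i = 1..n. (x i)\<^sup>2)" for x :: "nat \<Rightarrow> real"
    proof -
      have "(x j)\<^sup>2 \<le> (\<Sum>i = 1..n. (x i)\<^sup>2)" if "j \<in> {1..n}" for j
        using that by (intro member_le_sum[where f = "\<lambda>i. (x i)\<^sup>2"]) auto
      from this[OF assms(1)] this[OF assms(2)]
      have "(x i)\<^sup>2 + (x k)\<^sup>2 \<le> 2 * (\<Sum>i = 1..n. (x i)\<^sup>2)" by simp
      moreover have "2 * \<bar>x i * x k\<bar> \<le> (x i)\<^sup>2 + (x k)\<^sup>2"
        using sum_squares_bound[of "\<bar>x i\<bar>" "\<bar>x k\<bar>"] by (simp add: abs_mult)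
      ultimately show ?thesis by simp
    qed
  qed (rule borel_measurable_std_gaussian[OF m])
  show "(\<integral>x. x i * x k \<partial>std_gaussian n) = (if i = k then 1 else 0)"
  proof (cases "i = k")
    case True
    then show ?thesis using integral_std_gaussian_square[OF assms(1)] by (simp add: power2_eq_square)
  next
    case False
    \<comment> \<open>Changing the sign of coordinate \<open>i\<close> alone preserves the measure and negates the product.\<close>
    have "(\<integral>x. x i * x k \<partial>std_gaussian n) = (\<integral>x. - (x i * x k) \<partial>std_gaussian n)"
      using integral_std_gaussian_flip[of n "\<lambda>j. if j = i then -1 else 1", OF _ m] assms False by simp
    then show ?thesis using False by simp
  qed
qed

section \<open>Squared norms of projections onto monotone cones\<close>

text \<open>
  If \<open>C\<close> is the closed convex cone of vectors on \<open>{a..<b}\<close> that are nondecreasing with entries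
  in \<open>S\<close>, where \<open>S\<close> is \<open>UNIV\<close>, \<open>{0..}\<close> or \<open>{..0}\<close>, this supremum is \<open>\<parallel>\<Pi>\<^sub>C x\<parallel>\<^sup>2\<close>, because \<open>\<parallel>\<Pi>\<^sub>C
  x\<parallel>\<^sup>2 = \<parallel>x\<parallel>\<^sup>2 - inf\<^sub>v \<parallel>x - v\<parallel>\<^sup>2\<close>. In the variational form every property below follows by
  modifying a competitor \<open>v\<close>, and the isotonic regression itself never has to be computed.
\<close>

definition isotonic_gain :: "real set \<Rightarrow> nat \<Rightarrow> nat \<Rightarrow> (nat \<Rightarrow> real) \<Rightarrow> real" where
  "isotonic_gain S a b x =
     (SUP v \<in> {v. mono_on {a..<b} v \<and> v ` {a..<b} \<subseteq> S}. \<Sum>i = a..<b. 2 * x i * v i - (v i)\<^sup>2)"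

lemma gain_term_le: "(\<Sum>i = a..<b. 2 * x i * v i - (v i)\<^sup>2) \<le> (\<Sum>i = a..<b. (x i :: real)\<^sup>2)"
  by (intro sum_mono) (use sum_squares_bound in \<open>simp add: algebra_simps\<close>)

lemma isotonic_gain_bdd:
  "bdd_above ((\<lambda>v. \<Sum>i = a..<b. 2 * x i * v i - (v i)\<^sup>2) ` (A :: (nat \<Rightarrow> real) set))"
  by (rule bdd_aboveI2) (rule gain_term_le)

lemma isotonic_gain_upper:
  assumes "mono_on {a..<b} v" "v ` {a..<b} \<subseteq> S"
  shows "(\<Sum>i = a..<b. 2 * x i * v i - (v i)\<^sup>2) \<le> isotonic_gain S a b x"
  unfolding isotonic_gain_def by (rule cSUP_upper) (use assms isotonic_gain_bdd in auto)

lemma isotonic_gain_least: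
  assumes "0 \<in> S"
    and "\<And>v. mono_on {a..<b} v \<Longrightarrow> v ` {a..<b} \<subseteq> S \<Longrightarrow>
            (\<Sum>i = a..<b. 2 * x i * v i - (v i)\<^sup>2) \<le> z"
  shows "isotonic_gain S a b x \<le> z"
  unfolding isotonic_gain_def
proof (rule cSUP_least)
  have "(\<lambda>_. 0) \<in> {v. mono_on {a..<b} v \<and> v ` {a..<b} \<subseteq> S}"
    using assms(1) by (auto intro: mono_onI)
  then show "{v. mono_on {a..<b} v \<and> v ` {a..<b} \<subseteq> S} \<noteq> {}" by blast
qed (use assms(2) in auto)

lemma isotonic_gain_bounds:
  assumes "0 \<in> S"
  shows "0 \<le> isotonic_gain S a b x" "isotonic_gain S a b x \<le> (\<Sum>i = a..<b. (x i)\<^sup>2)"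
proof -
  show "0 \<le> isotonic_gain S a b x"
    using isotonic_gain_upper[of a b "\<lambda>_. 0" S x] assms by (auto intro: mono_onI)
  show "isotonic_gain S a b x \<le> (\<Sum>i = a..<b. (x i)\<^sup>2)"
    using assms by (rule isotonic_gain_least) (rule gain_term_le)
qed

lemma isotonic_gain_cong:
  assumes "\<And>i. i \<in> {a..<b} \<Longrightarrow> x i = y i"
  shows "isotonic_gain S a b x = isotonic_gain S a b y"
  unfolding isotonic_gain_def using assms by (intro SUP_cong sum.cong) auto

text \<open>
  A supremum of continuous functions is lower semicontinuous, even over an uncountable family.
\<close>

lemma borel_measurable_isotonic_gain [measurable]:
  assumes "0 \<in> S"
  shows "isotonic_gain S a b \<in> borel_measurable borel"
proof (rule borel_measurableI_greater)
  fix y :: real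
  define A where "A = {v. mono_on {a..<b} v \<and> v ` {a..<b} \<subseteq> S}"
  have "A \<noteq> {}" using assms by (auto simp: A_def intro!: exI[of _ "\<lambda>_. 0"] mono_onI)
  then have "{x \<in> space borel. y < isotonic_gain S a b x}
      = (\<Union>v\<in>A. {x. y < (\<Sum>i = a..<b. 2 * x i * v i - (v i)\<^sup>2)})"
    unfolding isotonic_gain_def A_def[symmetric] by (auto simp: less_cSUP_iff isotonic_gain_bdd)
  moreover have "open {x. y < (\<Sum>i = a..<b. 2 * x i * v i - (v i)\<^sup>2)}" for v
    by (intro open_Collect_less continuous_intros continuous_on_product_coordinates)
  ultimately show "{x \<in> space borel. y < isotonic_gain S a b x} \<in> sets borel"
    by (simp add: borel_open open_UN)
qed

text \<open>
  Subtracting the entry \<open>v k\<close> that is closest to \<open>0\<close> does not lower the objective when the sum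
  of \<open>x\<close> pulls \<open>v\<close> towards \<open>0\<close>. This is why the two sign-constrained problems lose their
  coordinate next to \<open>0\<close> in the two lemmas that follow.
\<close>

lemma gain_term_recenter:
  fixes x v :: "nat \<Rightarrow> real"
  assumes "v k * (\<Sum>i = a..<b. x i) \<le> 0" "\<And>i. i \<in> {a..<b} \<Longrightarrow> 0 \<le> v k * (v i - v k)"
  shows "(\<Sum>i = a..<b. 2 * x i * v i - (v i)\<^sup>2)
           \<le> (\<Sum>i = a..<b. 2 * x i * (v i - v k) - (v i - v k)\<^sup>2)"
proof -
  have "(\<Sum>i = a..<b. 2 * x i * (v i - v k) - (v i - v k)\<^sup>2)
      = (\<Sum>i = a..<b. (2 * x i * v i - (v i)\<^sup>2) - 2 * (v k * x i) + (2 * (v k * (v i - v k)) + (v k)\<^sup>2))"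
    by (intro sum.cong) (auto simp: power2_eq_square algebra_simps)
  also have "\<dots> = (\<Sum>i = a..<b. 2 * x i * v i - (v i)\<^sup>2) - 2 * (v k * (\<Sum>i = a..<b. x i))
      + (\<Sum>i = a..<b. 2 * (v k * (v i - v k)) + (v k)\<^sup>2)"
    by (simp add: sum.distrib sum_subtractf sum_distrib_left)
  moreover have "0 \<le> (\<Sum>i = a..<b. 2 * (v k * (v i - v k)) + (v k)\<^sup>2)"
    using assms(2) by (intro sum_nonneg) auto
  ultimately show ?thesis using assms(1) by simp
qed

lemma isotonic_gain_nonpos_drop_last:
  assumes "a \<le> b" "0 \<le> (\<Sum>i = a..<Suc b. x i)"
  shows "isotonic_gain {..0} a (Suc b) x = isotonic_gain {..0} a b x"
proof (rule antisym)
  show "isotonic_gain {..0} a (Suc b) x \<le> isotonic_gain {..0} a b x"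
  proof (rule isotonic_gain_least)
    fix v assume v: "mono_on {a..<Suc b} v" "v ` {a..<Suc b} \<subseteq> {..0::real}"
    have vb: "v i \<le> v b" if "i \<in> {a..<Suc b}" for i
      using that by (intro mono_onD[OF v(1)]) auto
    have b0: "v b \<le> 0" using v(2) assms(1) by (auto simp: image_subset_iff)
    have "(\<Sum>i = a..<Suc b. 2 * x i * v i - (v i)\<^sup>2)
        \<le> (\<Sum>i = a..<Suc b. 2 * x i * (v i - v b) - (v i - v b)\<^sup>2)"
      using assms(2) b0 vb by (intro gain_term_recenter mult_nonpos_nonneg mult_nonpos_nonpos) auto
    also have "\<dots> = (\<Sum>i = a..<b. 2 * x i * (v i - v b) - (v i - v b)\<^sup>2)"
      using assms(1) by simp
    also have "\<dots> \<le> isotonic_gain {..0} a b x"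
      using vb mono_onD[OF v(1)] by (intro isotonic_gain_upper mono_onI) auto
    finally show "(\<Sum>i = a..<Suc b. 2 * x i * v i - (v i)\<^sup>2) \<le> isotonic_gain {..0} a b x" .
  qed simp
  show "isotonic_gain {..0} a b x \<le> isotonic_gain {..0} a (Suc b) x"
  proof (rule isotonic_gain_least)
    fix v assume v: "mono_on {a..<b} v" "v ` {a..<b} \<subseteq> {..0::real}"
    define w where "w = v(b := 0)"
    have "(\<Sum>i = a..<b. 2 * x i * v i - (v i)\<^sup>2) = (\<Sum>i = a..<b. 2 * x i * w i - (w i)\<^sup>2)"
      by (intro sum.cong) (auto simp: w_def)
    also have "\<dots> = (\<Sum>i = a..<Suc b. 2 * x i * w i - (w i)\<^sup>2)"
      using assms(1) by (simp add: w_def)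
    also have "\<dots> \<le> isotonic_gain {..0} a (Suc b) x"
    proof (rule isotonic_gain_upper)
      show "mono_on {a..<Suc b} w"
        using v(2) mono_onD[OF v(1)] by (intro mono_onI) (auto simp: w_def image_subset_iff)
      show "w ` {a..<Suc b} \<subseteq> {..0}" using v(2) by (auto simp: w_def image_subset_iff)
    qed
    finally show "(\<Sum>i = a..<b. 2 * x i * v i - (v i)\<^sup>2) \<le> isotonic_gain {..0} a (Suc b) x" .
  qed simp
qed

lemma isotonic_gain_nonneg_drop_first:
  assumes "a < b" "(\<Sum>i = a..<b. x i) \<le> 0"
  shows "isotonic_gain {0..} a b x = isotonic_gain {0..} (Suc a) b x"
proof (rule antisym)
  show "isotonic_gain {0..} a b x \<le> isotonic_gain {0..} (Suc a) b x"
  proof (rule isotonic_gain_least)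
    fix v assume v: "mono_on {a..<b} v" "v ` {a..<b} \<subseteq> {0::real..}"
    have va: "v a \<le> v i" if "i \<in> {a..<b}" for i
      using that by (intro mono_onD[OF v(1)]) auto
    have a0: "0 \<le> v a" using v(2) assms(1) by (auto simp: image_subset_iff)
    have "(\<Sum>i = a..<b. 2 * x i * v i - (v i)\<^sup>2)
        \<le> (\<Sum>i = a..<b. 2 * x i * (v i - v a) - (v i - v a)\<^sup>2)"
      using assms(2) a0 va by (intro gain_term_recenter mult_nonneg_nonneg mult_nonneg_nonpos) auto
    also have "\<dots> = (\<Sum>i = Suc a..<b. 2 * x i * (v i - v a) - (v i - v a)\<^sup>2)"
      using assms(1) by (simp add: sum.atLeast_Suc_lessThan)
    also have "\<dots> \<le> isotonic_gain {0..} (Suc a) b x"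
      using va mono_onD[OF v(1)] by (intro isotonic_gain_upper mono_onI) auto
    finally show "(\<Sum>i = a..<b. 2 * x i * v i - (v i)\<^sup>2) \<le> isotonic_gain {0..} (Suc a) b x" .
  qed simp
  show "isotonic_gain {0..} (Suc a) b x \<le> isotonic_gain {0..} a b x"
  proof (rule isotonic_gain_least)
    fix v assume v: "mono_on {Suc a..<b} v" "v ` {Suc a..<b} \<subseteq> {0::real..}"
    define w where "w = v(a := 0)"
    have "(\<Sum>i = Suc a..<b. 2 * x i * v i - (v i)\<^sup>2) = (\<Sum>i = Suc a..<b. 2 * x i * w i - (w i)\<^sup>2)"
      by (intro sum.cong) (auto simp: w_def)
    also have "\<dots> = (\<Sum>i = a..<b. 2 * x i * w i - (w i)\<^sup>2)"
      using assms(1) by (simp add: w_def sum.atLeast_Suc_lessThan)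
    also have "\<dots> \<le> isotonic_gain {0..} a b x"
    proof (rule isotonic_gain_upper)
      show "mono_on {a..<b} w"
        using v(2) mono_onD[OF v(1)] by (intro mono_onI) (auto simp: w_def image_subset_iff)
      show "w ` {a..<b} \<subseteq> {0..}" using v(2) by (auto simp: w_def image_subset_iff)
    qed
    finally show "(\<Sum>i = Suc a..<b. 2 * x i * v i - (v i)\<^sup>2) \<le> isotonic_gain {0..} a b x" .
  qed simp
qed

text \<open>
  Upper bound: cut \<open>v\<close> into its negative and positive parts. Lower bound: a nonpositive and a
  nonnegative competitor add up to a monotone one, and their inner product is at most \<open>0\<close>.
\<close>

lemma isotonic_gain_split_sign:
  "isotonic_gain UNIV a b x = isotonic_gain {..0} a b x + isotonic_gain {0..} a b x"
proof (rule antisym)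
  show "isotonic_gain UNIV a b x \<le> isotonic_gain {..0} a b x + isotonic_gain {0..} a b x"
  proof (rule isotonic_gain_least)
    fix v :: "nat \<Rightarrow> real" assume v: "mono_on {a..<b} v"
    have "(\<Sum>i = a..<b. 2 * x i * v i - (v i)\<^sup>2)
        = (\<Sum>i = a..<b. 2 * x i * min (v i) 0 - (min (v i) 0)\<^sup>2)
          + (\<Sum>i = a..<b. 2 * x i * max (v i) 0 - (max (v i) 0)\<^sup>2)"
      unfolding sum.distrib[symmetric] by (intro sum.cong) (auto simp: min_def max_def)
    also have "\<dots> \<le> isotonic_gain {..0} a b x + isotonic_gain {0..} a b x"
      by (intro add_mono isotonic_gain_upper mono_onI min.mono max.mono mono_onD[OF v]) auto
    finally show "(\<Sum>i = a..<b. 2 * x i * v i - (v i)\<^sup>2)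
        \<le> isotonic_gain {..0} a b x + isotonic_gain {0..} a b x" .
  qed simp
  have *: "(\<Sum>i = a..<b. 2 * x i * u i - (u i)\<^sup>2) + (\<Sum>i = a..<b. 2 * x i * w i - (w i)\<^sup>2)
      \<le> isotonic_gain UNIV a b x"
    if u: "mono_on {a..<b} u" "u ` {a..<b} \<subseteq> {..0}"
    and w: "mono_on {a..<b} w" "w ` {a..<b} \<subseteq> {0..}" for u w :: "nat \<Rightarrow> real"
  proof -
    have "(\<Sum>i = a..<b. 2 * x i * u i - (u i)\<^sup>2) + (\<Sum>i = a..<b. 2 * x i * w i - (w i)\<^sup>2)
        \<le> (\<Sum>i = a..<b. 2 * x i * (u i + w i) - (u i + w i)\<^sup>2)"
      unfolding sum.distrib[symmetric]
    proof (rule sum_mono)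
      fix i assume "i \<in> {a..<b}"
      then have "u i * w i \<le> 0" using u(2) w(2) by (intro mult_nonpos_nonneg) (auto simp: image_subset_iff)
      then show "2 * x i * u i - (u i)\<^sup>2 + (2 * x i * w i - (w i)\<^sup>2) \<le> 2 * x i * (u i + w i) - (u i + w i)\<^sup>2"
        by (simp add: power2_eq_square algebra_simps)
    qed
    also have "\<dots> \<le> isotonic_gain UNIV a b x"
      using mono_onD[OF u(1)] mono_onD[OF w(1)]
      by (intro isotonic_gain_upper mono_onI add_mono) auto
    finally show ?thesis .
  qed
  have "isotonic_gain {0..} a b x \<le> isotonic_gain UNIV a b x - isotonic_gain {..0} a b x"
  proof (rule isotonic_gain_least)
    fix w assume w: "mono_on {a..<b} w" "w ` {a..<b} \<subseteq> {0::real..}"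
    have "isotonic_gain {..0} a b x \<le> isotonic_gain UNIV a b x - (\<Sum>i = a..<b. 2 * x i * w i - (w i)\<^sup>2)"
      using *[OF _ _ w] by (intro isotonic_gain_least) (auto simp: le_diff_eq)
    then show "(\<Sum>i = a..<b. 2 * x i * w i - (w i)\<^sup>2) \<le> isotonic_gain UNIV a b x - isotonic_gain {..0} a b x"
      by simp
  qed simp
  then show "isotonic_gain {..0} a b x + isotonic_gain {0..} a b x \<le> isotonic_gain UNIV a b x" by simp
qed

text \<open>
  The cone of all monotone vectors contains the constants, so \<open>v\<close> can be translated with \<open>x\<close>.
\<close>

lemma isotonic_gain_translate:
  "isotonic_gain UNIV a b (\<lambda>i. x i + c)
     = isotonic_gain UNIV a b x + 2 * c * (\<Sum>i = a..<b. x i) + real (b - a) * c\<^sup>2"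
proof -
  have le: "isotonic_gain UNIV a b x + 2 * c * (\<Sum>i = a..<b. x i) + real (b - a) * c\<^sup>2
      \<le> isotonic_gain UNIV a b (\<lambda>i. x i + c)" for x c
  proof -
    have "isotonic_gain UNIV a b x
        \<le> isotonic_gain UNIV a b (\<lambda>i. x i + c) - (2 * c * (\<Sum>i = a..<b. x i) + real (b - a) * c\<^sup>2)"
    proof (rule isotonic_gain_least)
      fix v :: "nat \<Rightarrow> real" assume v: "mono_on {a..<b} v"
      have "(\<Sum>i = a..<b. 2 * x i * v i - (v i)\<^sup>2) + (2 * c * (\<Sum>i = a..<b. x i) + real (b - a) * c\<^sup>2)
          = (\<Sum>i = a..<b. 2 * x i * v i - (v i)\<^sup>2 + (2 * c * x i + c\<^sup>2))"
        by (simp add: sum.distrib sum_distrib_left)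
      also have "\<dots> = (\<Sum>i = a..<b. 2 * (x i + c) * (v i + c) - (v i + c)\<^sup>2)"
        by (intro sum.cong) (auto simp: power2_eq_square algebra_simps)
      also have "\<dots> \<le> isotonic_gain UNIV a b (\<lambda>i. x i + c)"
        using mono_onD[OF v] by (intro isotonic_gain_upper mono_onI) auto
      finally show "(\<Sum>i = a..<b. 2 * x i * v i - (v i)\<^sup>2)
          \<le> isotonic_gain UNIV a b (\<lambda>i. x i + c) - (2 * c * (\<Sum>i = a..<b. x i) + real (b - a) * c\<^sup>2)"
        by simp
    qed simp
    then show ?thesis by simp
  qed
  \<comment> \<open>The opposite inequality is the same one for the inverse translation.\<close>
  from le[of x c] le[of "\<lambda>i. x i + c" "- c"] show ?thesis
    by (simp add: sum.distrib power2_eq_square algebra_simps)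
qed

lemma isotonic_gain_Suc:
  assumes "0 \<in> S"
  shows "isotonic_gain S (Suc a) (Suc b) x = isotonic_gain S a b (\<lambda>i. x (Suc i))"
proof (rule antisym)
  show "isotonic_gain S (Suc a) (Suc b) x \<le> isotonic_gain S a b (\<lambda>i. x (Suc i))"
  proof (rule isotonic_gain_least[OF assms])
    fix v assume v: "mono_on {Suc a..<Suc b} v" "v ` {Suc a..<Suc b} \<subseteq> S"
    show "(\<Sum>i = Suc a..<Suc b. 2 * x i * v i - (v i)\<^sup>2) \<le> isotonic_gain S a b (\<lambda>i. x (Suc i))"
      unfolding sum.shift_bounds_Suc_ivl
      using v(2) mono_onD[OF v(1)] by (intro isotonic_gain_upper mono_onI) auto
  qed
  show "isotonic_gain S a b (\<lambda>i. x (Suc i)) \<le> isotonic_gain S (Suc a) (Suc b) x"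
  proof (rule isotonic_gain_least[OF assms])
    fix v assume v: "mono_on {a..<b} v" "v ` {a..<b} \<subseteq> S"
    have "(\<Sum>i = a..<b. 2 * x (Suc i) * v i - (v i)\<^sup>2)
        = (\<Sum>i = Suc a..<Suc b. 2 * x i * v (i - 1) - (v (i - 1))\<^sup>2)"
      unfolding sum.shift_bounds_Suc_ivl by simp
    also have "\<dots> \<le> isotonic_gain S (Suc a) (Suc b) x"
    proof (rule isotonic_gain_upper)
      show "mono_on {Suc a..<Suc b} (\<lambda>i. v (i - 1))"
        by (intro mono_onI mono_onD[OF v(1)]) auto
      show "(\<lambda>i. v (i - 1)) ` {Suc a..<Suc b} \<subseteq> S"
      proof (rule image_subsetI)
        fix i assume "i \<in> {Suc a..<Suc b}"
        then have "i - 1 \<in> {a..<b}" by auto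
        then show "v (i - 1) \<in> S" using v(2) by blast
      qed
    qed
    finally show "(\<Sum>i = a..<b. 2 * x (Suc i) * v i - (v i)\<^sup>2) \<le> isotonic_gain S (Suc a) (Suc b) x" .
  qed
qed

lemma isotonic_gain_reflect:
  "isotonic_gain {0..} a b x = isotonic_gain {..0} a b (\<lambda>i. - x (a + b - Suc i))"
proof -
  have sum_refl: "(\<Sum>i = a..<b. f i) = (\<Sum>i = a..<b. f (a + b - Suc i))" for f :: "nat \<Rightarrow> real"
    by (rule sum.reindex_bij_witness[where i = "\<lambda>i. a + b - Suc i" and j = "\<lambda>i. a + b - Suc i"]) auto
  have le: "isotonic_gain S a b x \<le> isotonic_gain (uminus ` S) a b (\<lambda>i. - x (a + b - Suc i))"
    if "0 \<in> S" for S and x :: "nat \<Rightarrow> real"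
  proof (rule isotonic_gain_least[OF that])
    fix v assume v: "mono_on {a..<b} v" "v ` {a..<b} \<subseteq> S"
    have "(\<Sum>i = a..<b. 2 * x i * v i - (v i)\<^sup>2)
        = (\<Sum>i = a..<b. 2 * (- x (a + b - Suc i)) * (- v (a + b - Suc i)) - (- v (a + b - Suc i))\<^sup>2)"
      by (subst sum_refl) simp
    also have "\<dots> \<le> isotonic_gain (uminus ` S) a b (\<lambda>i. - x (a + b - Suc i))"
    proof (rule isotonic_gain_upper)
      show "mono_on {a..<b} (\<lambda>i. - v (a + b - Suc i))"
        by (intro mono_onI) (auto intro!: mono_onD[OF v(1)])
      show "(\<lambda>i. - v (a + b - Suc i)) ` {a..<b} \<subseteq> uminus ` S"
      proof -
        have "v i \<in> S" if "a \<le> i" "i < b" for i using v(2) that by auto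
        then show ?thesis by (intro image_subsetI imageI) auto
      qed
    qed
    finally show "(\<Sum>i = a..<b. 2 * x i * v i - (v i)\<^sup>2)
        \<le> isotonic_gain (uminus ` S) a b (\<lambda>i. - x (a + b - Suc i))" .
  qed
  have "isotonic_gain {0..} a b x = isotonic_gain {0..} a b (\<lambda>i. - (- x (a + b - Suc (a + b - Suc i))))"
    by (rule isotonic_gain_cong) auto
  \<comment> \<open>Reflection is an involution, so one inequality applied twice gives equality.\<close>
  with le[of "{0..}" x] le[of "{..0}" "\<lambda>i. - x (a + b - Suc i)"] show ?thesis
    by simp
qed

section \<open>The expected gain is a harmonic number\<close>

lemma borel_measurable_centred_gain:
  assumes "0 \<in> S"
  shows "(\<lambda>x. isotonic_gain S a b (\<lambda>i. x i - (\<Sum>k = c..<d. x k) / m)) \<in> borel_measurable borel"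
proof -
  have "(\<lambda>x i. x i - (\<Sum>k = c..<d. x k) / m) \<in> measurable (borel :: (nat \<Rightarrow> real) measure) borel"
    by (rule measurable_coordinatewise_then_product) measurable
  from measurable_compose[OF this borel_measurable_isotonic_gain[OF assms]] show ?thesis .
qed

lemma integrable_isotonic_gain:
  assumes "0 \<in> S" "1 \<le> a" "b \<le> Suc n"
  shows "integrable (std_gaussian n) (isotonic_gain S a b)"
proof (rule integrable_std_gaussian_dominated[where K = 1])
  show "\<bar>isotonic_gain S a b x\<bar> \<le> 1 * (\<Sum>i = 1..n. (x i)\<^sup>2)" for x
  proof -
    have "(\<Sum>i = a..<b. (x i)\<^sup>2) \<le> (\<Sum>i = 1..n. (x i)\<^sup>2)"
      using assms by (intro sum_mono2) auto
    with isotonic_gain_bounds[OF assms(1), of a b x] show ?thesis by simp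
  qed
qed (intro borel_measurable_std_gaussian borel_measurable_isotonic_gain assms)

lemma sum_sq_deviation_le:
  fixes x :: "nat \<Rightarrow> real"
  assumes "a < b"
  shows "(\<Sum>i = a..<b. (x i - (\<Sum>k = a..<b. x k) / real (b - a))\<^sup>2) \<le> (\<Sum>i = a..<b. (x i)\<^sup>2)"
proof -
  define m where "m = real (b - a)"
  define s where "s = (\<Sum>k = a..<b. x k)"
  have m: "0 < m" using assms by (simp add: m_def)
  have "(\<Sum>i = a..<b. (x i - s / m)\<^sup>2) = (\<Sum>i = a..<b. (x i)\<^sup>2 - 2 * (s / m) * x i + (s / m)\<^sup>2)"
    by (intro sum.cong) (auto simp: power2_eq_square algebra_simps)
  also have "\<dots> = (\<Sum>i = a..<b. (x i)\<^sup>2) - 2 * (s / m) * s + m * (s / m)\<^sup>2"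
    using assms by (simp add: sum.distrib sum_subtractf sum_distrib_left s_def m_def of_nat_diff)
  also have "\<dots> = (\<Sum>i = a..<b. (x i)\<^sup>2) - s\<^sup>2 / m"
    using m by (simp add: power2_eq_square field_simps)
  also have "\<dots> \<le> (\<Sum>i = a..<b. (x i)\<^sup>2)" using m by simp
  finally show ?thesis by (simp add: s_def m_def)
qed

text \<open>
  Centre the block \<open>{a..<Suc b}\<close>, of length \<open>m\<close>, at its mean \<open>c\<close>, which has variance \<open>1 / m\<close>.
  The centred vector \<open>y\<close> sums to \<open>0\<close>, so its nonpositive gain lives on the block without its
  last entry and its nonnegative gain on the block without its first entry. A cyclic rotation
  of the block preserves both the measure and \<open>c\<close> and carries the second of these to the block
  without its last entry. In expectation the gain of \<open>y\<close> is therefore the same on \<open>{a..<Suc b}\<close>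
  and on \<open>{a..<b}\<close>. Undoing the centring adds \<open>E (m c\<^sup>2) = 1\<close> on the long block and \<open>E ((m + 1)
  c\<^sup>2 - 2 c x\<^sub>b) = 1 - 1 / m\<close> on the short one.
\<close>

lemma integral_isotonic_gain_Suc:
  assumes "1 \<le> a" "a \<le> b" "b \<le> n"
  shows "(\<integral>x. isotonic_gain UNIV a (Suc b) x \<partial>std_gaussian n)
           = (\<integral>x. isotonic_gain UNIV a b x \<partial>std_gaussian n) + 1 / real (Suc b - a)"
proof -
  define m where "m = real (Suc b - a)"
  define c where "c x = (\<Sum>k = a..<Suc b. x k) / m" for x :: "nat \<Rightarrow> real"
  define y where "y x = (\<lambda>i. x i - c x)" for x :: "nat \<Rightarrow> real"
  have m: "0 < m" "m = real (b - a) + 1" using assms by (auto simp: m_def)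
  have y_sum: "(\<Sum>i = a..<Suc b. y x i) = 0" for x
    using m(1) unfolding y_def c_def by (subst sum_subtractf) (simp add: m_def flip: of_nat_Suc)
  have whole: "isotonic_gain UNIV a (Suc b) x
      = isotonic_gain {..0} a b (y x) + isotonic_gain {0..} (Suc a) (Suc b) (y x) + m * (c x)\<^sup>2" for x
  proof -
    have "isotonic_gain UNIV a (Suc b) x = isotonic_gain UNIV a (Suc b) (\<lambda>i. y x i + c x)"
      by (simp add: y_def)
    also have "\<dots> = isotonic_gain UNIV a (Suc b) (y x) + m * (c x)\<^sup>2"
      unfolding isotonic_gain_translate y_sum by (simp add: m_def)
    also have "isotonic_gain UNIV a (Suc b) (y x)
        = isotonic_gain {..0} a b (y x) + isotonic_gain {0..} (Suc a) (Suc b) (y x)"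
      unfolding isotonic_gain_split_sign
      using isotonic_gain_nonpos_drop_last[of a b "y x"]
        isotonic_gain_nonneg_drop_first[of a "Suc b" "y x"] y_sum[of x] assms(2) by simp
    finally show ?thesis .
  qed
  have part: "isotonic_gain UNIV a b x
      = isotonic_gain {..0} a b (y x) + isotonic_gain {0..} a b (y x)
        + ((m + 1) * (c x)\<^sup>2 - 2 * (c x * x b))" for x
  proof -
    have "isotonic_gain UNIV a b x = isotonic_gain UNIV a b (\<lambda>i. y x i + c x)"
      by (simp add: y_def)
    also have "\<dots> = isotonic_gain UNIV a b (y x) + 2 * c x * (\<Sum>i = a..<b. y x i) + (m - 1) * (c x)\<^sup>2"
      unfolding isotonic_gain_translate by (simp add: m(2))
    also have "(\<Sum>i = a..<b. y x i) = - y x b"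
      using y_sum[of x] assms(2) by simp
    finally show ?thesis
      unfolding isotonic_gain_split_sign by (simp add: y_def power2_eq_square algebra_simps)
  qed
  have yint: "integrable (std_gaussian n) (\<lambda>x. isotonic_gain S a' b' (y x))"
    if "0 \<in> S" "a \<le> a'" "b' \<le> Suc b" for S a' b'
  proof (rule integrable_std_gaussian_dominated[where K = 1])
    show "(\<lambda>x. isotonic_gain S a' b' (y x)) \<in> borel_measurable (std_gaussian n)"
      unfolding y_def c_def
      by (intro borel_measurable_std_gaussian borel_measurable_centred_gain that)
    show "\<bar>isotonic_gain S a' b' (y x)\<bar> \<le> 1 * (\<Sum>i = 1..n. (x i)\<^sup>2)" for x
    proof -
      have "isotonic_gain S a' b' (y x) \<le> (\<Sum>i = a'..<b'. (y x i)\<^sup>2)"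
        by (rule isotonic_gain_bounds(2)[OF that(1)])
      also have "\<dots> \<le> (\<Sum>i = a..<Suc b. (y x i)\<^sup>2)"
        using that by (intro sum_mono2) auto
      also have "\<dots> \<le> (\<Sum>i = a..<Suc b. (x i)\<^sup>2)"
        using sum_sq_deviation_le[of a "Suc b" x] assms(2) by (simp add: y_def c_def m_def)
      also have "\<dots> \<le> (\<Sum>i = 1..n. (x i)\<^sup>2)"
        using assms by (intro sum_mono2) auto
      finally show ?thesis using isotonic_gain_bounds(1)[OF that(1), of a' b' "y x"] by simp
    qed
  qed
  have rot: "(\<integral>x. isotonic_gain {0..} (Suc a) (Suc b) (y x) \<partial>std_gaussian n)
      = (\<integral>x. isotonic_gain {0..} a b (y x) \<partial>std_gaussian n)"
  proof -
    define \<pi> where "\<pi> i = (if i = b then a else if a \<le> i \<and> i < b then Suc i else i)" for i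
    have inj: "inj_on \<pi> A" for A
      using assms(2) by (auto simp: inj_on_def \<pi>_def split: if_splits)
    have "c (\<lambda>i\<in>{1..n}. x (\<pi> i)) = c x" for x
    proof -
      have "(\<Sum>k = a..<Suc b. (\<lambda>i\<in>{1..n}. x (\<pi> i)) k) = (\<Sum>k = a..<Suc b. x (\<pi> k))"
        using assms by (intro sum.cong) auto
      also have "\<dots> = (\<Sum>k = a..<Suc b. x k)"
      proof (rule sum.reindex_bij_betw)
        have "\<pi> ` {a..<Suc b} = {a..<Suc b}"
          by (rule endo_inj_surj[OF _ _ inj]) (use assms in \<open>auto simp: \<pi>_def\<close>)
        then show "bij_betw \<pi> {a..<Suc b} {a..<Suc b}"
          using inj by (simp add: bij_betw_def)
      qed
      finally show ?thesis by (simp add: c_def)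
    qed
    then have "isotonic_gain {0..} a b (y (\<lambda>i\<in>{1..n}. x (\<pi> i))) = isotonic_gain {0..} (Suc a) (Suc b) (y x)" for x
      unfolding isotonic_gain_Suc[of "{0..}", simplified]
      using assms by (intro isotonic_gain_cong) (auto simp: y_def \<pi>_def)
    moreover have "(\<integral>x. isotonic_gain {0..} a b (y x) \<partial>std_gaussian n)
        = (\<integral>x. isotonic_gain {0..} a b (y (\<lambda>i\<in>{1..n}. x (\<pi> i))) \<partial>std_gaussian n)"
    proof (rule integral_std_gaussian_permute[OF inj])
      show "\<pi> \<in> {1..n} \<rightarrow> {1..n}" using assms by (auto simp: \<pi>_def)
      show "(\<lambda>x. isotonic_gain {0..} a b (y x)) \<in> borel_measurable borel"
        unfolding y_def c_def by (rule borel_measurable_centred_gain) simp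
    qed
    ultimately show ?thesis by simp
  qed
  have cx: "integrable (std_gaussian n) (\<lambda>x. c x * x j)"
      "(\<integral>x. c x * x j \<partial>std_gaussian n) = 1 / m" if "j \<in> {a..<Suc b}" for j
  proof -
    have e: "c x * x j = (\<Sum>k = a..<Suc b. x k * x j) / m" for x
      by (simp only: c_def times_divide_eq_left sum_distrib_right)
    have i: "integrable (std_gaussian n) (\<lambda>x. x k * x j)"
        "(\<integral>x. x k * x j \<partial>std_gaussian n) = (if k = j then 1 else 0)" if "k \<in> {a..<Suc b}" for k
      using that \<open>j \<in> _\<close> assms
      by (intro integrable_std_gaussian_times integral_std_gaussian_times; simp)+
    show "integrable (std_gaussian n) (\<lambda>x. c x * x j)"
      unfolding e by (intro integrable_divide Bochner_Integration.integrable_sum i)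
    have "(\<integral>x. c x * x j \<partial>std_gaussian n)
        = (\<Sum>k = a..<Suc b. (\<integral>x. x k * x j \<partial>std_gaussian n)) / m"
      unfolding e by (simp add: Bochner_Integration.integral_sum i del: sum.op_ivl_Suc)
    also have "(\<Sum>k = a..<Suc b. (\<integral>x. x k * x j \<partial>std_gaussian n)) = (\<Sum>k = a..<Suc b. if k = j then 1 else 0)"
      by (rule sum.cong[OF refl i(2)])
    also have "\<dots> = 1" using that by (simp del: sum.op_ivl_Suc)
    finally show "(\<integral>x. c x * x j \<partial>std_gaussian n) = 1 / m" .
  qed
  have cc: "integrable (std_gaussian n) (\<lambda>x. (c x)\<^sup>2)" "(\<integral>x. (c x)\<^sup>2 \<partial>std_gaussian n) = 1 / m"
  proof -
    have e: "(c x)\<^sup>2 = (\<Sum>j = a..<Suc b. c x * x j) / m" for x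
      by (simp only: sum_distrib_left[symmetric]) (simp add: c_def power2_eq_square)
    show "integrable (std_gaussian n) (\<lambda>x. (c x)\<^sup>2)"
      unfolding e by (intro integrable_divide Bochner_Integration.integrable_sum cx)
    have "(\<integral>x. (c x)\<^sup>2 \<partial>std_gaussian n) = (\<Sum>j = a..<Suc b. (\<integral>x. c x * x j \<partial>std_gaussian n)) / m"
      unfolding e by (simp add: Bochner_Integration.integral_sum cx del: sum.op_ivl_Suc)
    also have "(\<Sum>j = a..<Suc b. (\<integral>x. c x * x j \<partial>std_gaussian n)) = (\<Sum>j = a..<Suc b. 1 / m)"
      by (rule sum.cong[OF refl cx(2)])
    also have "\<dots> = 1" using m(1) by (simp add: m_def del: sum.op_ivl_Suc)
    finally show "(\<integral>x. (c x)\<^sup>2 \<partial>std_gaussian n) = 1 / m" .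
  qed
  have b: "b \<in> {a..<Suc b}" using assms by simp
  have 1: "(\<integral>x. isotonic_gain UNIV a (Suc b) x \<partial>std_gaussian n)
      = (\<integral>x. isotonic_gain {..0} a b (y x) \<partial>std_gaussian n)
        + (\<integral>x. isotonic_gain {0..} (Suc a) (Suc b) (y x) \<partial>std_gaussian n) + 1"
    unfolding whole using m(1) by (simp add: yint cc)
  have 2: "(\<integral>x. isotonic_gain UNIV a b x \<partial>std_gaussian n)
      = (\<integral>x. isotonic_gain {..0} a b (y x) \<partial>std_gaussian n)
        + (\<integral>x. isotonic_gain {0..} a b (y x) \<partial>std_gaussian n) + ((m + 1) * (1 / m) - 2 * (1 / m))"
    unfolding part by (simp add: yint cc cx[OF b])
  have "(m + 1) * (1 / m) - 2 * (1 / m) = 1 - 1 / m" using m(1) by (simp add: field_simps)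
  then show ?thesis using 1 2 rot by (simp add: m_def)
qed

lemma integral_isotonic_gain:
  assumes "1 \<le> a" "a + m \<le> Suc n"
  shows "(\<integral>x. isotonic_gain UNIV a (a + m) x \<partial>std_gaussian n) = harm m"
  using assms(2)
proof (induction m)
  case 0
  have "isotonic_gain UNIV a a x = 0" for x
    using isotonic_gain_bounds[of UNIV a a x] by simp
  then show ?case by (simp add: harm_def)
next
  case (Suc m)
  then show ?case
    using integral_isotonic_gain_Suc[of a "a + m" n] assms(1)
    by (simp add: harm_Suc inverse_eq_divide)
qed

text \<open>
  Reflecting the block and changing all signs exchanges nonpositive and nonnegative
  competitors, so each of the two carries half of the expected monotone gain.
\<close>

lemma integral_isotonic_gain_nonpos:
  assumes "1 \<le> a" "a + m \<le> Suc n"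
  shows "(\<integral>x. isotonic_gain {..0} a (a + m) x \<partial>std_gaussian n) = harm m / 2"
proof -
  define \<pi> where "\<pi> i = (if a \<le> i \<and> i < a + m then a + (a + m) - Suc i else i)" for i
  have inj: "inj_on \<pi> {1..n}"
    by (auto simp: inj_on_def \<pi>_def split: if_splits)
  have mem: "\<pi> \<in> {1..n} \<rightarrow> {1..n}" using assms by (auto simp: \<pi>_def)
  have meas: "isotonic_gain S a (a + m) \<in> borel_measurable borel" if "0 \<in> S" for S
    using that by (rule borel_measurable_isotonic_gain)
  have meas': "(\<lambda>x. isotonic_gain {..0} a (a + m) (\<lambda>i\<in>{1..n}. - 1 * x i)) \<in> borel_measurable borel"
  proof -
    have "(\<lambda>x. \<lambda>i\<in>{1..n}. - 1 * x i) \<in> measurable (borel :: (nat \<Rightarrow> real) measure) borel"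
      by (rule measurable_coordinatewise_then_product) (simp add: restrict_def)
    from measurable_compose[OF this borel_measurable_isotonic_gain] show ?thesis by simp
  qed
  have "(\<integral>x. isotonic_gain {..0} a (a + m) x \<partial>std_gaussian n)
      = (\<integral>x. isotonic_gain {..0} a (a + m) (\<lambda>i\<in>{1..n}. - 1 * x i) \<partial>std_gaussian n)"
    using integral_std_gaussian_flip[of n "\<lambda>_. - 1", OF _ meas] by simp
  also have "\<dots> = (\<integral>x. isotonic_gain {..0} a (a + m) (\<lambda>i\<in>{1..n}. - 1 * (\<lambda>i\<in>{1..n}. x (\<pi> i)) i) \<partial>std_gaussian n)"
    by (rule integral_std_gaussian_permute[OF inj mem meas'])
  also have "\<dots> = (\<integral>x. isotonic_gain {0..} a (a + m) x \<partial>std_gaussian n)"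
    unfolding isotonic_gain_reflect
    using assms by (intro Bochner_Integration.integral_cong isotonic_gain_cong) (auto simp: \<pi>_def)
  finally have "(\<integral>x. isotonic_gain {..0} a (a + m) x \<partial>std_gaussian n)
      = (\<integral>x. isotonic_gain {0..} a (a + m) x \<partial>std_gaussian n)" .
  moreover have "(\<integral>x. isotonic_gain UNIV a (a + m) x \<partial>std_gaussian n)
      = (\<integral>x. isotonic_gain {..0} a (a + m) x \<partial>std_gaussian n)
        + (\<integral>x. isotonic_gain {0..} a (a + m) x \<partial>std_gaussian n)"
    unfolding isotonic_gain_split_sign
    using assms by (intro Bochner_Integration.integral_add integrable_isotonic_gain) auto
  ultimately show ?thesis
    using integral_isotonic_gain[OF assms] by simp
qed

section \<open>The rescaled error for vanishing noise\<close>

text \<open>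
  The observation is restricted to \<open>{1..n}\<close> because this is the form in which a sample of
  \<open>gaussian_iso n \<mu> \<sigma>\<close> is expressed through standard Gaussian noise \<open>Z\<close>.
\<close>

definition rescaled_error :: "nat \<Rightarrow> real \<Rightarrow> (nat \<Rightarrow> real) \<Rightarrow> (nat \<Rightarrow> real) \<Rightarrow> real \<Rightarrow> real" where
  "rescaled_error n V \<mu> Z \<sigma> =
     1 / \<sigma>\<^sup>2 * (\<Sum>i = 1..n. (tf_estimator n V (\<lambda>i\<in>{1..n}. \<mu> i + \<sigma> * Z i) i - \<mu> i)\<^sup>2)"

lemma tf_estimator_cong:
  assumes "0 \<le> V" "\<And>i. i \<in> {1..n} \<Longrightarrow> x i = y i" "i \<in> {1..n}"
  shows "tf_estimator n V x i = tf_estimator n V y i"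
proof -
  have "(\<Sum>i = 1..n. (tf_estimator n V x i - tf_estimator n V y i)\<^sup>2) \<le> (\<Sum>i = 1..n. (x i - y i)\<^sup>2)"
    by (rule tf_estimator_lipschitz[OF assms(1)])
  also have "\<dots> = 0" using assms(2) by simp
  finally have "(\<Sum>i = 1..n. (tf_estimator n V x i - tf_estimator n V y i)\<^sup>2) = 0"
    by (intro antisym) (simp_all add: sum_nonneg)
  then show ?thesis using assms(3) by (simp add: sum_nonneg_eq_0_iff)
qed

lemma rescaled_error_unrestricted:
  assumes "0 \<le> V"
  shows "rescaled_error n V \<mu> Z \<sigma> =
     1 / \<sigma>\<^sup>2 * (\<Sum>i = 1..n. (tf_estimator n V (\<lambda>i. \<mu> i + \<sigma> * Z i) i - \<mu> i)\<^sup>2)"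
proof -
  have "tf_estimator n V (\<lambda>i\<in>{1..n}. \<mu> i + \<sigma> * Z i) i = tf_estimator n V (\<lambda>i. \<mu> i + \<sigma> * Z i) i"
    if "i \<in> {1..n}" for i
    by (rule tf_estimator_cong[OF assms _ that]) simp
  then show ?thesis by (simp add: rescaled_error_def)
qed

lemma rescaled_error_antimono:
  assumes "0 \<le> V" "0 < s" "s \<le> \<sigma>"
  shows "rescaled_error n V \<mu> Z \<sigma> \<le> rescaled_error n V \<mu> Z s"
  unfolding rescaled_error_unrestricted[OF assms(1)] by (rule noise_ray_monotone[OF assms])

lemma rescaled_error_bounds:
  assumes "0 \<le> V" "total_variation n \<mu> \<le> V" "0 < \<sigma>"
  shows "0 \<le> rescaled_error n V \<mu> Z \<sigma>" "rescaled_error n V \<mu> Z \<sigma> \<le> (\<Sum>i = 1..n. (Z i)\<^sup>2)"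
proof -
  show "0 \<le> rescaled_error n V \<mu> Z \<sigma>"
    unfolding rescaled_error_def by (simp add: sum_nonneg)
  have "(\<Sum>i = 1..n. (tf_estimator n V (\<lambda>i. \<mu> i + \<sigma> * Z i) i - \<mu> i)\<^sup>2)
      = (\<Sum>i = 1..n. (tf_estimator n V (\<lambda>i. \<mu> i + \<sigma> * Z i) i - tf_estimator n V \<mu> i)\<^sup>2)"
    by (intro sum.cong) (simp_all add: tf_estimator_feasible assms)
  also have "\<dots> \<le> (\<Sum>i = 1..n. (\<mu> i + \<sigma> * Z i - \<mu> i)\<^sup>2)"
    by (rule tf_estimator_lipschitz[OF assms(1)])
  also have "\<dots> = \<sigma>\<^sup>2 * (\<Sum>i = 1..n. (Z i)\<^sup>2)"
    by (simp add: power_mult_distrib sum_distrib_left)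
  finally show "rescaled_error n V \<mu> Z \<sigma> \<le> (\<Sum>i = 1..n. (Z i)\<^sup>2)"
    unfolding rescaled_error_unrestricted[OF assms(1)] using assms(3)
    by (simp add: field_simps)
qed

text \<open>
  Without measurability the Bochner integral in the risk would be \<open>0\<close> by default. The estimator is
  Lipschitz in the first \<open>n\<close> coordinates, hence continuous in the product topology.
\<close>

lemma borel_measurable_tf_estimator:
  assumes "0 \<le> V" "i \<in> {1..n}"
  shows "(\<lambda>Y. tf_estimator n V Y i) \<in> borel_measurable borel"
proof (rule borel_measurable_continuous_onI)
  have "((\<lambda>Y. tf_estimator n V Y i) \<longlongrightarrow> tf_estimator n V Y0 i) (at Y0)" for Y0
  proof -
    have "continuous_on UNIV (\<lambda>Y :: nat \<Rightarrow> real. Y k)" for k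
      by (rule continuous_on_product_coordinates)
    then have "((\<lambda>Y. Y k) \<longlongrightarrow> Y0 k) (at Y0)" for k
      by (simp add: continuous_on_def)
    then have "((\<lambda>Y. L2_set (\<lambda>k. Y k - Y0 k) {1..n}) \<longlongrightarrow> L2_set (\<lambda>k. Y0 k - Y0 k) {1..n}) (at Y0)"
      unfolding L2_set_def by (intro tendsto_intros)
    then have lim: "((\<lambda>Y. L2_set (\<lambda>k. Y k - Y0 k) {1..n}) \<longlongrightarrow> 0) (at Y0)"
      by (simp add: L2_set_def)
    have le: "norm (tf_estimator n V Y i - tf_estimator n V Y0 i) \<le> L2_set (\<lambda>k. Y k - Y0 k) {1..n}" for Y
    proof -
      have "(tf_estimator n V Y i - tf_estimator n V Y0 i)\<^sup>2
          \<le> (\<Sum>i = 1..n. (tf_estimator n V Y i - tf_estimator n V Y0 i)\<^sup>2)"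
        using assms(2) by (intro member_le_sum[where f = "\<lambda>i. (tf_estimator n V Y i - tf_estimator n V Y0 i)\<^sup>2"]) auto
      also have "\<dots> \<le> (\<Sum>k = 1..n. (Y k - Y0 k)\<^sup>2)"
        by (rule tf_estimator_lipschitz[OF assms(1)])
      finally show ?thesis
        unfolding L2_set_def by (intro real_le_rsqrt) simp
    qed
    have "((\<lambda>Y. tf_estimator n V Y i - tf_estimator n V Y0 i) \<longlongrightarrow> 0) (at Y0)"
      by (rule Lim_null_comparison[OF always_eventually[OF allI[OF le]] lim])
    then show ?thesis by (rule LIM_zero_cancel)
  qed
  then show "continuous_on UNIV (\<lambda>Y. tf_estimator n V Y i)"
    by (simp add: continuous_at_imp_continuous_on isCont_def)
qed

lemma borel_measurable_squared_error:
  assumes "0 \<le> V"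
  shows "(\<lambda>Y. (eucl_dist n (tf_estimator n V Y) \<mu>)\<^sup>2) \<in> borel_measurable borel"
  unfolding eucl_dist_sq
  by (intro borel_measurable_sum borel_measurable_power borel_measurable_diff
      borel_measurable_tf_estimator[OF assms]) auto

lemma borel_measurable_rescaled_error:
  assumes "0 \<le> V"
  shows "(\<lambda>Z. rescaled_error n V \<mu> Z \<sigma>) \<in> borel_measurable borel"
proof -
  have "(\<lambda>Z. \<lambda>i\<in>{1..n}. \<mu> i + \<sigma> * Z i) \<in> measurable (borel :: (nat \<Rightarrow> real) measure) borel"
    by (rule measurable_coordinatewise_then_product) (simp add: restrict_def)
  from measurable_compose[OF this borel_measurable_squared_error[OF assms]] show ?thesis
    unfolding rescaled_error_def eucl_dist_sq by (intro borel_measurable_times) auto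
qed

lemma integrable_rescaled_error:
  assumes "0 \<le> V" "total_variation n \<mu> \<le> V" "0 < \<sigma>"
  shows "integrable (std_gaussian n) (\<lambda>Z. rescaled_error n V \<mu> Z \<sigma>)"
  by (rule integrable_std_gaussian_dominated[where K = 1])
     (use rescaled_error_bounds[OF assms] in
       \<open>simp_all add: borel_measurable_std_gaussian borel_measurable_rescaled_error assms(1)\<close>)

lemma rescaled_risk_eq:
  assumes "0 \<le> V" "0 < \<sigma>"
  shows "1 / \<sigma>\<^sup>2 * risk n \<sigma> (tf_estimator n V) \<mu>
           = 1 / real n * (\<integral>Z. rescaled_error n V \<mu> Z \<sigma> \<partial>std_gaussian n)"
proof -
  have "(\<integral>Y. (eucl_dist n (tf_estimator n V Y) \<mu>)\<^sup>2 \<partial>gaussian_iso n \<mu> \<sigma>)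
      = (\<integral>Z. (eucl_dist n (tf_estimator n V (\<lambda>i\<in>{1..n}. \<mu> i + \<sigma> * Z i)) \<mu>)\<^sup>2 \<partial>std_gaussian n)"
    using assms(2) by (intro integral_gaussian_iso_affine borel_measurable_squared_error assms(1)) auto
  then show ?thesis
    unfolding risk_def rescaled_error_def eucl_dist_sq by simp
qed

lemma antimono_bounded_tendsto_at_right:
  fixes f :: "real \<Rightarrow> real"
  assumes anti: "\<And>s t. 0 < s \<Longrightarrow> s \<le> t \<Longrightarrow> f t \<le> f s" and bdd: "\<And>t. 0 < t \<Longrightarrow> f t \<le> B"
  obtains L where "(f \<longlongrightarrow> L) (at_right 0)" "\<And>t. 0 < t \<Longrightarrow> f t \<le> L"
proof
  have b: "bdd_above (f ` {0<..})" using bdd by (intro bdd_aboveI2) auto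
  show le: "f t \<le> (SUP t\<in>{0<..}. f t)" if "0 < t" for t
    using that b by (intro cSUP_upper) auto
  show "(f \<longlongrightarrow> (SUP t\<in>{0<..}. f t)) (at_right 0)"
  proof (rule order_tendstoI)
    fix a assume "a < (SUP t\<in>{0<..}. f t)"
    then obtain t where t: "0 < t" "a < f t" using b by (auto simp: less_cSUP_iff)
    show "\<forall>\<^sub>F s in at_right 0. a < f s"
      unfolding eventually_at_right_field
      using t anti by (intro exI[of _ t]) (auto intro: less_le_trans less_imp_le)
  next
    fix a assume "(SUP t\<in>{0<..}. f t) < a"
    then show "\<forall>\<^sub>F s in at_right 0. f s < a"
      unfolding eventually_at_right_field
      using le by (intro exI[of _ 1]) (auto intro: le_less_trans)
  qed
qed

text \<open>
  Put \<open>u = (p - \<mu>) / \<sigma>\<close>, where \<open>p\<close> is the estimator. The variational inequality at the feasible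
  point \<open>\<mu> + t w\<close> reads \<open>t \<langle>Z - u, w\<rangle> \<le> \<sigma> \<langle>Z - u, u\<rangle>\<close>, and \<open>\<langle>Z - u, u\<rangle> \<le> \<parallel>Z\<parallel>\<^sup>2\<close>. Thus \<open>\<langle>Z, w\<rangle>\<close>
  exceeds \<open>\<langle>u, w\<rangle>\<close> by at most a multiple of \<open>\<sigma>\<close>, while \<open>2 \<langle>u, w\<rangle> - \<parallel>w\<parallel>\<^sup>2 \<le> \<parallel>u\<parallel>\<^sup>2\<close>. As \<open>\<sigma>\<close> tends
  to \<open>0\<close>, every feasible direction \<open>w\<close> becomes a competitor for the limit.
\<close>

lemma rescaled_error_tangent:
  assumes V: "0 \<le> V" and \<mu>: "total_variation n \<mu> \<le> V" and \<sigma>: "0 < \<sigma>" and t: "0 < t"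
    and w: "total_variation n (\<lambda>i. \<mu> i + t * w i) \<le> V"
  shows "(\<Sum>i = 1..n. 2 * Z i * w i - (w i)\<^sup>2)
           \<le> rescaled_error n V \<mu> Z \<sigma> + 2 * \<sigma> / t * (\<Sum>i = 1..n. (Z i)\<^sup>2)"
proof -
  define u where "u i = (tf_estimator n V (\<lambda>i. \<mu> i + \<sigma> * Z i) i - \<mu> i) / \<sigma>" for i
  define ZZ where "ZZ = (\<Sum>i = 1..n. (Z i)\<^sup>2)"
  have p: "tf_estimator n V (\<lambda>i. \<mu> i + \<sigma> * Z i) i = \<mu> i + \<sigma> * u i" for i
    using \<sigma> by (simp add: u_def)
  have R: "rescaled_error n V \<mu> Z \<sigma> = (\<Sum>i = 1..n. (u i)\<^sup>2)"
    unfolding rescaled_error_unrestricted[OF V] u_def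
    by (simp add: power_divide sum_divide_distrib)
  have RZ: "(\<Sum>i = 1..n. (u i)\<^sup>2) \<le> ZZ"
    using rescaled_error_bounds(2)[OF V \<mu> \<sigma>, of Z] by (simp add: R ZZ_def)
  have "(\<Sum>i = 1..n. (\<mu> i + \<sigma> * Z i - (\<mu> i + \<sigma> * u i)) * (\<mu> i + t * w i - (\<mu> i + \<sigma> * u i))) \<le> 0"
    using tf_estimator_variational[OF V w, of "\<lambda>i. \<mu> i + \<sigma> * Z i"] by (simp only: p)
  also have "(\<Sum>i = 1..n. (\<mu> i + \<sigma> * Z i - (\<mu> i + \<sigma> * u i)) * (\<mu> i + t * w i - (\<mu> i + \<sigma> * u i)))
      = \<sigma> * (t * (\<Sum>i = 1..n. (Z i - u i) * w i) - \<sigma> * (\<Sum>i = 1..n. (Z i - u i) * u i))"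
    unfolding sum_distrib_left sum_subtractf[symmetric]
    by (intro sum.cong) (auto simp: algebra_simps)
  finally have "t * (\<Sum>i = 1..n. (Z i - u i) * w i) \<le> \<sigma> * (\<Sum>i = 1..n. (Z i - u i) * u i)"
    using \<sigma> by (simp add: mult_le_0_iff)
  also have "\<dots> \<le> \<sigma> * ZZ"
  proof -
    have "(\<Sum>i = 1..n. (Z i - u i) * u i) \<le> (\<Sum>i = 1..n. (Z i)\<^sup>2)"
    proof (rule sum_mono)
      fix i
      have "0 \<le> (Z i - u i)\<^sup>2 + (Z i)\<^sup>2 + (u i)\<^sup>2" by simp
      then show "(Z i - u i) * u i \<le> (Z i)\<^sup>2" by (simp add: power2_eq_square algebra_simps)
    qed
    then show ?thesis using \<sigma> by (simp add: ZZ_def)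
  qed
  finally have 1: "(\<Sum>i = 1..n. (Z i - u i) * w i) \<le> \<sigma> / t * ZZ"
    using t by (simp add: field_simps)
  have "(\<Sum>i = 1..n. 2 * Z i * w i - (w i)\<^sup>2)
      = 2 * (\<Sum>i = 1..n. (Z i - u i) * w i) + (\<Sum>i = 1..n. 2 * u i * w i - (w i)\<^sup>2)"
    unfolding sum_distrib_left sum.distrib[symmetric] by (intro sum.cong) (auto simp: algebra_simps)
  also have "(\<Sum>i = 1..n. 2 * u i * w i - (w i)\<^sup>2) \<le> (\<Sum>i = 1..n. (u i)\<^sup>2)"
    by (intro sum_mono) (use sum_squares_bound in \<open>simp add: algebra_simps\<close>)
  finally show ?thesis using 1 by (simp add: R ZZ_def)
qed

text \<open>
  For \<open>n = 2\<close> the jump index is \<open>1\<close>, so the signal is constant and has no jump; this is why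
  \<open>2 < n\<close> is required here.
\<close>

lemma step_signal_jump:
  assumes "2 < n"
  obtains j where "2 \<le> j" "j \<le> n" "real n / 2 \<le> real (Suc n - j)"
    "\<forall>i\<in>{1..n}. step_signal n i = (if i < j then 0 else 1)"
proof
  define j where "j = nat \<lceil>real n / 2\<rceil>"
  have j: "int j = \<lceil>real n / 2\<rceil>" using assms by (simp add: j_def)
  have 1: "real n / 2 \<le> real j" "real j < real n / 2 + 1"
  proof -
    have "real j = of_int \<lceil>real n / 2\<rceil>" by (simp flip: j)
    then show "real n / 2 \<le> real j" "real j < real n / 2 + 1" by linarith+
  qed
  show "2 \<le> j" using 1(1) assms by linarith
  show "j \<le> n" using 1(2) assms by linarith
  show "real n / 2 \<le> real (Suc n - j)" using 1(2) \<open>j \<le> n\<close> by (simp add: of_nat_diff)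
  show "\<forall>i\<in>{1..n}. step_signal n i = (if i < j then 0 else 1)"
    by (simp add: step_signal_def flip: j)
qed

text \<open>
  What the upper part of the signal gains in variation by becoming increasing, from \<open>j\<close> to \<open>n\<close>,
  it recovers at the jump, which shrinks to \<open>1 + t v\<^sub>j\<close>: the total is \<open>1 + t v\<^sub>n \<le> 1\<close>. The
  condition \<open>- 1 \<le> t v\<^sub>j\<close> keeps the jump nonnegative.
\<close>

lemma total_variation_step_perturbed:
  assumes j: "2 \<le> j" "j \<le> n"
    and \<mu>: "\<And>i. i \<in> {1..n} \<Longrightarrow> \<mu> i = (if i < j then 0 else 1)"
    and v: "mono_on {j..<Suc n} v" "v ` {j..<Suc n} \<subseteq> {..0}"
    and t: "0 \<le> t" "- 1 \<le> t * v j"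
  shows "total_variation n (\<lambda>i. \<mu> i + t * (if j \<le> i then v i else 0)) \<le> 1"
proof -
  define \<theta> where "\<theta> i = \<mu> i + t * (if j \<le> i then v i else 0)" for i
  have \<theta>: "\<theta> i = (if i < j then 0 else 1 + t * v i)" if "i \<in> {1..n}" for i
    using \<mu>[OF that] by (simp add: \<theta>_def)
  have "total_variation n \<theta> = (\<Sum>i = 2..<Suc n. \<bar>\<theta> i - \<theta> (i - 1)\<bar>)"
    unfolding total_variation_def by (simp add: atLeastLessThanSuc_atLeastAtMost)
  also have "\<dots> = (\<Sum>i = 2..<j. \<bar>\<theta> i - \<theta> (i - 1)\<bar>) + (\<Sum>i = j..<Suc n. \<bar>\<theta> i - \<theta> (i - 1)\<bar>)"
    using j by (subst sum.atLeastLessThan_concat) auto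
  also have "(\<Sum>i = 2..<j. \<bar>\<theta> i - \<theta> (i - 1)\<bar>) = 0"
  proof (rule sum.neutral, rule ballI)
    fix i assume "i \<in> {2..<j}"
    then have "\<theta> i = 0" "\<theta> (i - 1) = 0" using j by (subst \<theta>; auto)+
    then show "\<bar>\<theta> i - \<theta> (i - 1)\<bar> = 0" by simp
  qed
  also have "(\<Sum>i = j..<Suc n. \<bar>\<theta> i - \<theta> (i - 1)\<bar>)
      = \<bar>\<theta> j - \<theta> (j - 1)\<bar> + (\<Sum>i = Suc j..<Suc n. \<bar>\<theta> i - \<theta> (i - 1)\<bar>)"
    using j by (subst sum.atLeast_Suc_lessThan) auto
  also have "\<bar>\<theta> j - \<theta> (j - 1)\<bar> = 1 + t * v j"
  proof -
    have "\<theta> j = 1 + t * v j" "\<theta> (j - 1) = 0" using j by (subst \<theta>; auto)+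
    then show ?thesis using t(2) by simp
  qed
  also have "(\<Sum>i = Suc j..<Suc n. \<bar>\<theta> i - \<theta> (i - 1)\<bar>) = (\<Sum>i = j..<n. \<bar>\<theta> (Suc i) - \<theta> i\<bar>)"
    unfolding sum.shift_bounds_Suc_ivl by simp
  also have "\<dots> = (\<Sum>i = j..<n. t * v (Suc i) - t * v i)"
  proof (rule sum.cong)
    fix i assume i: "i \<in> {j..<n}"
    then have "v i \<le> v (Suc i)" by (intro mono_onD[OF v(1)]) auto
    then have "t * v i \<le> t * v (Suc i)" using t(1) by (rule mult_left_mono)
    then show "\<bar>\<theta> (Suc i) - \<theta> i\<bar> = t * v (Suc i) - t * v i" using i j by (simp add: \<theta>)
  qed simp
  also have "\<dots> = t * v n - t * v j"
    using j(2) by (rule sum_Suc_diff'[where f = "\<lambda>i. t * v i"])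
  also have "0 + (1 + t * v j + (t * v n - t * v j)) \<le> 1"
    using v(2) j(2) t(1) by (auto simp: image_subset_iff mult_nonneg_nonpos)
  finally show ?thesis unfolding \<theta>_def .
qed

lemma gain_le_limit_rescaled_error:
  assumes j: "2 \<le> j" "j \<le> n"
    and \<mu>: "\<And>i. i \<in> {1..n} \<Longrightarrow> \<mu> i = (if i < j then 0 else 1)"
    and lim: "(\<lambda>k. rescaled_error n 1 \<mu> Z (1 / real (Suc k))) \<longlonglongrightarrow> D"
  shows "isotonic_gain {..0} j (Suc n) Z \<le> D"
proof (rule isotonic_gain_least)
  fix v assume v: "mono_on {j..<Suc n} v" "v ` {j..<Suc n} \<subseteq> {..0::real}"
  define w where "w i = (if j \<le> i then v i else 0)" for i
  \<comment> \<open>Small enough that the jump at \<open>j\<close> stays nonnegative.\<close>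
  define t where "t = 1 / (\<bar>v j\<bar> + 1)"
  have t: "0 < t" "- 1 \<le> t * v j" by (auto simp: t_def field_simps)
  have tv: "total_variation n (\<lambda>i. \<mu> i + t * w i) \<le> 1"
    unfolding w_def using t by (intro total_variation_step_perturbed[OF j \<mu> v]) auto
  have "total_variation n (\<lambda>i. \<mu> i + 0 * (if j \<le> i then v i else 0)) \<le> 1"
    by (intro total_variation_step_perturbed[OF j \<mu> v]) auto
  then have tv0: "total_variation n \<mu> \<le> 1" by simp
  have eq: "(\<Sum>i = 1..n. 2 * Z i * w i - (w i)\<^sup>2) = (\<Sum>i = j..<Suc n. 2 * Z i * v i - (v i)\<^sup>2)"
    using j by (intro sum.mono_neutral_cong_right) (auto simp: w_def)
  have "(\<lambda>k. rescaled_error n 1 \<mu> Z (1 / real (Suc k)) + 2 * (1 / real (Suc k)) / t * (\<Sum>i = 1..n. (Z i)\<^sup>2))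
      \<longlonglongrightarrow> D + 2 * 0 / t * (\<Sum>i = 1..n. (Z i)\<^sup>2)"
    using t(1) lim LIMSEQ_inverse_real_of_nat by (intro tendsto_intros) (auto simp: inverse_eq_divide)
  moreover have "(\<Sum>i = j..<Suc n. 2 * Z i * v i - (v i)\<^sup>2)
      \<le> rescaled_error n 1 \<mu> Z (1 / real (Suc k)) + 2 * (1 / real (Suc k)) / t * (\<Sum>i = 1..n. (Z i)\<^sup>2)" for k
    unfolding eq[symmetric] by (rule rescaled_error_tangent[OF _ tv0 _ t(1) tv]) auto
  ultimately show "(\<Sum>i = j..<Suc n. 2 * Z i * v i - (v i)\<^sup>2) \<le> D"
    by (intro LIMSEQ_le_const) auto
qed simp

text \<open>
  Along \<open>\<sigma> = 1 / (k + 1)\<close> the rescaled error increases to a limit that dominates the isotonic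
  gain pointwise. It stays below \<open>\<parallel>Z\<parallel>\<^sup>2\<close>, so expectations pass to the limit.
\<close>

lemma integral_gain_le_of_rescaled_error:
  assumes j: "2 \<le> j" "j \<le> n"
    and \<mu>: "\<And>i. i \<in> {1..n} \<Longrightarrow> \<mu> i = (if i < j then 0 else 1)"
    and tv: "total_variation n \<mu> \<le> 1"
    and B: "\<And>\<sigma>. 0 < \<sigma> \<Longrightarrow> (\<integral>Z. rescaled_error n 1 \<mu> Z \<sigma> \<partial>std_gaussian n) \<le> B"
  shows "(\<integral>Z. isotonic_gain {..0} j (Suc n) Z \<partial>std_gaussian n) \<le> B"
proof -
  define E where "E k Z = rescaled_error n 1 \<mu> Z (1 / real (Suc k))" for k Z
  define D where "D Z = lim (\<lambda>k. E k Z)" for Z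
  have E: "0 \<le> E k Z" "E k Z \<le> (\<Sum>i = 1..n. (Z i)\<^sup>2)" for k Z
    using rescaled_error_bounds[OF _ tv] by (auto simp: E_def)
  have mono: "E k Z \<le> E l Z" if "k \<le> l" for k l Z
    unfolding E_def using that by (intro rescaled_error_antimono) (auto intro!: divide_left_mono)
  have lim: "(\<lambda>k. E k Z) \<longlonglongrightarrow> D Z" for Z
  proof -
    have "incseq (\<lambda>k. E k Z)" using mono by (simp add: incseq_def)
    then have "convergent (\<lambda>k. E k Z)"
      using E(2)[of _ Z] by (auto intro: convergentI elim!: incseq_convergent)
    then show ?thesis unfolding D_def by (simp add: convergent_LIMSEQ_iff)
  qed
  have intE: "integrable (std_gaussian n) (E k)" for k
    unfolding E_def by (rule integrable_rescaled_error[OF _ tv]) auto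
  have D: "0 \<le> D Z" "D Z \<le> (\<Sum>i = 1..n. (Z i)\<^sup>2)" for Z
    using E lim by (auto intro: LIMSEQ_le_const[OF lim] LIMSEQ_le_const2[OF lim])
  have measD: "D \<in> borel_measurable (std_gaussian n)"
    by (rule borel_measurable_LIMSEQ_real[OF lim]) (use intE in auto)
  have intD: "integrable (std_gaussian n) D"
    by (rule integrable_std_gaussian_dominated[OF measD, where K = 1]) (use D in simp)
  have "(\<integral>Z. isotonic_gain {..0} j (Suc n) Z \<partial>std_gaussian n) \<le> (\<integral>Z. D Z \<partial>std_gaussian n)"
  proof (rule integral_mono[OF _ intD])
    show "integrable (std_gaussian n) (isotonic_gain {..0} j (Suc n))"
      using j by (intro integrable_isotonic_gain) auto
    show "isotonic_gain {..0} j (Suc n) Z \<le> D Z" for Z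
      by (rule gain_le_limit_rescaled_error[OF j \<mu>]) (use lim in \<open>simp_all add: E_def\<close>)
  qed
  also have "(\<integral>Z. D Z \<partial>std_gaussian n) \<le> B"
  proof (rule LIMSEQ_le_const2)
    show "(\<lambda>k. \<integral>Z. E k Z \<partial>std_gaussian n) \<longlonglongrightarrow> (\<integral>Z. D Z \<partial>std_gaussian n)"
    proof (rule integral_dominated_convergence)
      show "integrable (std_gaussian n) (\<lambda>Z. \<Sum>i = 1..n. (Z i)\<^sup>2)"
        by (intro Bochner_Integration.integrable_sum integrable_std_gaussian_square)
    qed (use E lim measD intE in auto)
    show "\<exists>N. \<forall>k\<ge>N. (\<integral>Z. E k Z \<partial>std_gaussian n) \<le> B"
      using B by (auto simp: E_def)
  qed
  finally show ?thesis .
qed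

lemma total_variation_step_signal: "total_variation n (step_signal n) \<le> 1"
proof (cases "2 < n")
  case True
  then obtain j where j: "2 \<le> j" "j \<le> n"
    and \<mu>: "\<forall>i\<in>{1..n}. step_signal n i = (if i < j then 0 else 1)"
    by (rule step_signal_jump)
  have "total_variation n (\<lambda>i. step_signal n i + 0 * (if j \<le> i then 0 else 0)) \<le> 1"
    by (rule total_variation_step_perturbed[OF j bspec[OF \<mu>]]) (auto intro: mono_onI)
  then show ?thesis by simp
next
  case False
  have "total_variation n (step_signal n) \<le> (\<Sum>i = 2..n. 1)"
    unfolding total_variation_def by (intro sum_mono) (use False in \<open>auto simp: step_signal_def\<close>)
  also have "\<dots> \<le> 1" using False by simp
  finally show ?thesis .
qed

section \<open>The small-noise risk at the step signal\<close>

theorem lemma2p4: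
  fixes n :: nat
  assumes "n \<ge> 2"
  shows "\<exists>L. ((\<lambda>\<sigma>. 1 / \<sigma>\<^sup>2 * risk n \<sigma> (tf_estimator n 1) (step_signal n)) \<longlongrightarrow> L) (at_right 0)
           \<and> L \<ge> ln (real n / 2) / (2 * real n)"
proof -
  note tv = total_variation_step_signal[of n]
  define I where "I \<sigma> = (\<integral>Z. rescaled_error n 1 (step_signal n) Z \<sigma> \<partial>std_gaussian n)" for \<sigma>
  have int: "integrable (std_gaussian n) (\<lambda>Z. rescaled_error n 1 (step_signal n) Z \<sigma>)" if "0 < \<sigma>" for \<sigma>
    using that by (intro integrable_rescaled_error tv) auto
  have "I t \<le> I s" if "0 < s" "s \<le> t" for s t
    unfolding I_def using that by (intro integral_mono int rescaled_error_antimono) auto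
  moreover have "I t \<le> (\<integral>Z. (\<Sum>i = 1..n. (Z i)\<^sup>2) \<partial>std_gaussian n)" if "0 < t" for t
    unfolding I_def using that
    by (intro integral_mono int rescaled_error_bounds tv Bochner_Integration.integrable_sum
        integrable_std_gaussian_square) auto
  ultimately obtain L where L: "(I \<longlongrightarrow> L) (at_right 0)" "\<And>t. 0 < t \<Longrightarrow> I t \<le> L"
    using antimono_bounded_tendsto_at_right by blast
  have "((\<lambda>\<sigma>. 1 / real n * I \<sigma>) \<longlongrightarrow> 1 / real n * L) (at_right 0)"
    by (intro tendsto_intros L)
  moreover have "\<forall>\<^sub>F \<sigma> in at_right 0. 1 / real n * I \<sigma>
      = 1 / \<sigma>\<^sup>2 * risk n \<sigma> (tf_estimator n 1) (step_signal n)"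
    using eventually_at_right_less[of 0]
    by eventually_elim (unfold I_def, rule rescaled_risk_eq[symmetric], auto)
  ultimately have "((\<lambda>\<sigma>. 1 / \<sigma>\<^sup>2 * risk n \<sigma> (tf_estimator n 1) (step_signal n)) \<longlongrightarrow> 1 / real n * L) (at_right 0)"
    by (rule Lim_transform_eventually)
  moreover have "ln (real n / 2) / 2 \<le> L"
  proof (cases "n = 2")
    case True
    \<comment> \<open>The claimed bound is \<open>ln 1 = 0\<close>, and the limit dominates the nonnegative value at \<open>\<sigma> = 1\<close>.\<close>
    have "0 \<le> I 1"
      unfolding I_def by (intro integral_nonneg_AE AE_I2 rescaled_error_bounds tv) auto
    with L(2)[of 1] True show ?thesis by simp
  next
    case False
    with assms have "2 < n" by simp
    then obtain j where j: "2 \<le> j" "j \<le> n" "real n / 2 \<le> real (Suc n - j)"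
      and \<mu>: "\<forall>i\<in>{1..n}. step_signal n i = (if i < j then 0 else 1)"
      by (rule step_signal_jump)
    have "ln (real n / 2) \<le> ln (real (Suc n - j) + 1)"
      using j assms by simp
    also have "\<dots> \<le> harm (Suc n - j)" by (rule ln_le_harm)
    finally have "ln (real n / 2) / 2 \<le> harm (Suc n - j) / 2" by simp
    also have "\<dots> = (\<integral>Z. isotonic_gain {..0} j (Suc n) Z \<partial>std_gaussian n)"
      using integral_isotonic_gain_nonpos[of j "Suc n - j" n] j by simp
    also have "\<dots> \<le> L"
      by (rule integral_gain_le_of_rescaled_error[OF j(1,2) bspec[OF \<mu>] tv]) (use L(2) in \<open>auto simp: I_def\<close>)
    finally show ?thesis .
  qed
  then have "ln (real n / 2) / (2 * real n) \<le> 1 / real n * L"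
    using assms by (simp add: field_simps)
  ultimately show ?thesis by blast
qed

end
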